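(* Let $n\ge1$, $1<p,q<\infty$, $1<\theta\le\infty$, $\alpha,\beta,s\in\mathbb{R}$, and assume $\frac1q\le\frac1p+\frac1\theta$. Then $$L^p_\alpha(\mathbb{R}^n)*L^\theta_s(\mathbb{R}^n)\subset L^q_{-\beta}(\mathbb{R}^n)$$ (i.e. there is $C>0$ with $\|f*K\|_{L^q_{-\beta}}\le C\|f\|_{L^p_\alpha}\|K\|_{L^\theta_s}$ for all $f\in L^p_\alpha$, $K\in L^\theta_s$) if and only if all of the following hold: $$\frac1q=\frac1p+\frac1\theta+\frac{\alpha+\beta+s}{n}-1;$$ $\alpha<n/p'$, $\beta<n/q$ and $s<n/\theta'$ if $\theta<\infty$, while $\alpha<n/p'$, $\beta<n/q$ and $0<s<n$ if $\theta=\infty$; and $$\alpha+\beta\ge0,\qquad\alpha+s\ge0,\qquad\beta+s\ge0 .$$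
   Context: For $t\in\mathbb{R}$ and $1\le p<\infty$, $L^p_t(\mathbb{R}^n)$ consists of measurable $f$ with $\|f\|_{L^p_t}=\left(\int_{\mathbb{R}^n}|f(x)|^p|x|^{tp}dx\right)^{1/p}<\infty$; for $p=\infty$, $\|f\|_{L^\infty_t}=\operatorname{ess\,sup}_x|f(x)||x|^t$. $(f*K)(x)=\int K(x-y)f(y)\,dy$. $p'=p/(p-1)$, $\theta'=\theta/(\theta-1)$ (with $\theta'=1$ for $\theta=\infty$). *)

theory Defs
  imports "HOL-Analysis.Analysis" "HOL-Probability.Essential_Supremum"
begin

definition wnorm :: "ereal \<Rightarrow> real \<Rightarrow> ('a::euclidean_space \<Rightarrow> real) \<Rightarrow> ennreal" where
  "wnorm p t f =
    (if p = \<infinity> then esssup lborel (\<lambda>x. ennreal (\<bar>f x\<bar> * norm x powr t))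
     else (let I = (\<integral>\<^sup>+ x. ennreal ((\<bar>f x\<bar> * norm x powr t) powr (real_of_ereal p)) \<partial>lborel)
           in if I = \<infinity> then \<infinity> else ennreal ((enn2real I) powr (1 / real_of_ereal p))))"

definition in_wL :: "ereal \<Rightarrow> real \<Rightarrow> ('a::euclidean_space \<Rightarrow> real) \<Rightarrow> bool" where
  "in_wL p t f \<longleftrightarrow> f \<in> borel_measurable lborel \<and> wnorm p t f < \<infinity>"

definition conv :: "('a::euclidean_space \<Rightarrow> real) \<Rightarrow> ('a \<Rightarrow> real) \<Rightarrow> 'a \<Rightarrow> real" where
  "conv f K x = (\<integral> y. K (x - y) * f y \<partial>lborel)"

definition inv_exp :: "ereal \<Rightarrow> real" where
  "inv_exp \<theta> = (if \<theta> = \<infinity> then 0 else 1 / real_of_ereal \<theta>)"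

end

theory Submission
  imports Defs
begin

text \<open>
  By duality the inequality is a bound for the trilinear form over triples \<open>x = y + w\<close> of the
  functions \<open>|y|\<^sup>-\<^sup>\<alpha> E\<^sub>1(y)\<^sup>1\<^sup>/\<^sup>p\<close>, \<open>|w|\<^sup>-\<^sup>s E\<^sub>2(w)\<^sup>1\<^sup>/\<^sup>\<theta>\<close>,
  \<open>|x|\<^sup>-\<^sup>\<beta> E\<^sub>3(x)\<^sup>1\<^sup>/\<^sup>q\<^sup>'\<close>, where the \<open>E\<^sub>i\<close> are nonnegative with integral at most 1. The
  integral is split according to which of the three points has the smallest norm; the two others are
  then comparable. Calling the smallest point \<open>x\<close>, put \<open>X = |x|\<^sup>n\<close>, \<open>R = (|y|/|x|)\<^sup>n \<ge> 1\<close> and let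
  \<open>W, U, V\<close> be \<open>X\<close> times the densities. By scaling the integrand is \<open>X\<^sup>-\<^sup>2 R\<^sup>-\<^sup>\<gamma> W\<^sup>D U\<^sup>A V\<^sup>B\<close>, and an
  elementary inequality dominates it by finitely many terms that are integrable by Tonelli: products
  of two densities, and one density times a kernel of bounded integral. If \<open>A + B > 1\<close> the factor
  \<open>R\<^sup>-\<^sup>\<gamma>\<close> is dropped and the kernels are \<open>X\<^sup>-\<^sup>1 min(t\<^sup>e, t\<^sup>-\<^sup>e)\<close> with \<open>t = X E(y)\<close>, which covers the endpoint
  cases (Hardy-Littlewood-Sobolev); if \<open>A + B \<le> 1\<close> then \<open>\<gamma> > 1 - (A + B)\<close> and the kernels come from the decay in \<open>R\<close>.

  Necessity: indicators of balls, suitably translated and dilated, give the scaling relation and the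
  three sum conditions; \<open>|x|\<^sup>-\<^sup>n\<close> on \<open>2\<^sup>-\<^sup>N < |x| \<le> 1\<close>, whose integral grows like \<open>N\<close>, gives the strict ones.
\<close>

section \<open>Pointwise inequalities\<close>

text \<open>The value 1 at exponent 0, even for \<open>t = 0\<close>, makes the density irrelevant when
  the Lebesgue exponent is infinite.\<close>
definition pw :: "real \<Rightarrow> real \<Rightarrow> real" where
  "pw t k = (if k = 0 then 1 else t powr k)"

lemma pw_nonneg: "0 \<le> pw t k"
  by (simp add: pw_def)

lemma pw_mult: "0 < c \<Longrightarrow> 0 \<le> t \<Longrightarrow> pw (c * t) k = c powr k * pw t k"
  by (simp add: pw_def powr_mult)

text \<open>Decay at both 0 and infinity makes \<open>bump e (norm x powr n * G)\<close> integrable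
  against the dilation invariant measure \<open>norm x powr (- n)\<close> dx, with a value that does
  not depend on G.\<close>

definition bump :: "real \<Rightarrow> real \<Rightarrow> real" where
  "bump e t = min (t powr e) (t powr (-e))"

lemma bump_nonneg: "0 \<le> bump e t"
  by (simp add: bump_def)

lemma bump_ge_1: "1 \<le> t \<Longrightarrow> 0 \<le> e \<Longrightarrow> t * bump e t = t powr (1 - e)"
  by (simp add: bump_def min_def powr_diff powr_minus divide_inverse)
     (smt (verit) ge_one_powr_ge_zero le_imp_inverse_le inverse_1 powr_gt_zero)

lemma bump_le_1: "0 < t \<Longrightarrow> t \<le> 1 \<Longrightarrow> 0 \<le> e \<Longrightarrow> t * bump e t = t powr (1 + e)"
  using powr_mono'[of "-e" e t] by (simp add: bump_def min_def powr_add)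

lemma powr_interpolate_le_max:
  fixes m r S :: real
  assumes "0 \<le> m" "0 \<le> r" "0 \<le> S" "S \<le> 1"
  shows "m powr S * r powr (1 - S) \<le> max m r"
proof -
  have "m powr S * r powr (1 - S) \<le> max m r powr S * max m r powr (1 - S)"
    using assms by (intro mult_mono powr_mono2) auto
  also have "\<dots> \<le> max m r"
    using assms by (simp add: powr_add[symmetric])
  finally show ?thesis .
qed

text \<open>All three bases are at least 1, so the exponent of the smallest may be raised to (1 - a)
  + (1 - b), the amounts by which the other two exponents fall short of 1; this power of z is then
  split and absorbed into x and y.\<close>

lemma powr_trade_smallest:
  fixes x y z a b c :: real
  assumes "1 \<le> z" "z \<le> x" "z \<le> y" "a \<le> 1" "b \<le> 1" "a + b + c \<le> 2"
  shows "x powr a * y powr b * z powr c \<le> x * y"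
proof -
  have "z powr c \<le> z powr ((1 - a) + (1 - b))"
    using assms by (intro powr_mono) auto
  also have "\<dots> = z powr (1 - a) * z powr (1 - b)" by (rule powr_add)
  also have "\<dots> \<le> x powr (1 - a) * y powr (1 - b)"
    using assms by (intro mult_mono powr_mono2) auto
  finally have "x powr a * y powr b * z powr c \<le> (x powr a * x powr (1 - a)) * (y powr b * y powr (1 - b))"
    by (smt (verit) mult.assoc mult.left_commute mult_left_mono mult_nonneg_nonneg powr_ge_zero)
  then show ?thesis using assms by (simp add: powr_add[symmetric])
qed

text \<open>Case distinction by whether U and V exceed 1. If only one does, the factor below 1 is
  dropped, and U^A is at most U^(1 - e), which is \<open>U * bump e U\<close>. If both are below 1,
  the total exponent of at least 1 + e produces the bump term of the larger one.\<close>

lemma powr_prod_le_bump: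
  fixes U V A B e :: real
  assumes UV: "0 < U" "0 < V" and AB: "0 < A" "0 < B" "A \<le> 1 - e" "B \<le> 1 - e" "1 + e \<le> A + B" "0 < e"
  shows "U powr A * V powr B \<le> U * V + U * bump e U + V * bump e V"
proof -
  have nn: "0 \<le> U * bump e U" "0 \<le> V * bump e V" "0 \<le> U * V" using UV bump_nonneg by auto
  consider "1 \<le> U" "1 \<le> V" | "1 \<le> U" "V \<le> 1" | "U \<le> 1" "1 \<le> V" | "U \<le> 1" "V \<le> 1" by linarith
  then show ?thesis
  proof cases
    case 1
    then have "U powr A * V powr B \<le> U powr 1 * V powr 1"
      using AB by (intro mult_mono powr_mono) auto
    then show ?thesis using nn UV by simp
  next
    case 2
    have "U powr A * V powr B \<le> U powr (1 - e) * 1"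
      using AB UV 2 by (intro mult_mono powr_mono) (auto simp: powr_le1)
    then show ?thesis using nn bump_ge_1[of U e] 2 AB by simp
  next
    case 3
    have "U powr A * V powr B \<le> 1 * V powr (1 - e)"
      using AB UV 3 by (intro mult_mono powr_mono) (auto simp: powr_le1)
    then show ?thesis using nn bump_ge_1[of V e] 3 AB by simp
  next
    case 4
    define m where "m = max U V"
    have m: "0 < m" "m \<le> 1" using UV 4 by (auto simp: m_def)
    have "U powr A * V powr B \<le> m powr A * m powr B"
      using AB UV by (intro mult_mono powr_mono2) (auto simp: m_def)
    also have "\<dots> = m powr (A + B)" by (simp add: powr_add)
    also have "\<dots> \<le> m powr (1 + e)" using m AB by (intro powr_mono') auto
    also have "\<dots> = m * bump e m" using bump_le_1[of m e] m AB by simp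
    also have "\<dots> \<le> U * bump e U + V * bump e V" using nn by (auto simp: m_def max_def)
    finally show ?thesis using nn by linarith
  qed
qed

text \<open>For W <= 1 the factor W^D is dropped, which leaves \<open>powr_prod_le_bump\<close>. For
  W > 1 the pairs alone suffice: if U and V are at least 1, the smallest of the three is traded for
  the other two, and this is where A + B + D <= 2 enters; otherwise W^D <= W, and U^A V^B is at most
  U, V or their maximum.\<close>

lemma pw_prod_le_pairs:
  fixes U V W A B D e :: real
  assumes nn: "0 \<le> U" "0 \<le> V" "0 \<le> W"
    and AB: "0 < A" "0 < B" "A \<le> 1 - e" "B \<le> 1 - e" "1 + e \<le> A + B" "0 < e"
    and D: "0 \<le> D" "D < 1" "A + B + D \<le> 2"
  shows "pw W D * pw U A * pw V B \<le> U * V + U * W + V * W + U * bump e U + V * bump e V"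
proof (cases "U = 0 \<or> V = 0")
  case True
  then have "pw W D * pw U A * pw V B = 0" using AB by (auto simp: pw_def)
  then show ?thesis using nn bump_nonneg by auto
next
  case False
  then have UV: "0 < U" "0 < V" using nn by auto
  have nn': "0 \<le> U * bump e U" "0 \<le> V * bump e V" "0 \<le> U * V" "0 \<le> U * W" "0 \<le> V * W"
    using nn bump_nonneg by auto
  have pwUV: "pw U A = U powr A" "pw V B = V powr B" using AB by (auto simp: pw_def)
  show ?thesis
  proof (cases "W \<le> 1")
    case True
    have "pw W D \<le> 1" using True nn D by (auto simp: pw_def powr_le1)
    then have "pw W D * (U powr A * V powr B) \<le> 1 * (U powr A * V powr B)"
      by (intro mult_right_mono) auto
    then show ?thesis using powr_prod_le_bump[OF UV AB] nn' by (simp add: pwUV mult.assoc)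
  next
    case False
    then have W: "1 < W" by simp
    have pwW: "pw W D = W powr D" using W by (simp add: pw_def)
    have WD: "W powr D \<le> W" using powr_mono[of D 1 W] W D by simp
    consider "1 \<le> U" "1 \<le> V" | "1 \<le> U" "V \<le> 1" | "U \<le> 1" "1 \<le> V" | "U \<le> 1" "V \<le> 1" by linarith
    then have "W powr D * (U powr A * V powr B) \<le> U * V + U * W + V * W"
    proof cases
      case 1
      consider "V \<le> U" "V \<le> W" | "U \<le> V" "U \<le> W" | "W \<le> U" "W \<le> V" by linarith
      then show ?thesis
      proof cases
        case a: 1
        have "W powr D * (U powr A * V powr B) \<le> U * W"
          using powr_trade_smallest[of V U W A D B] 1 a AB D W by (simp add: ac_simps)
        then show ?thesis using nn' by linarith
      next
        case a: 2
        have "W powr D * (U powr A * V powr B) \<le> V * W"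
          using powr_trade_smallest[of U V W B D A] 1 a AB D W by (simp add: ac_simps)
        then show ?thesis using nn' by linarith
      next
        case a: 3
        have "W powr D * (U powr A * V powr B) \<le> U * V"
          using powr_trade_smallest[of W U V A B D] 1 a AB D W by (simp add: ac_simps)
        then show ?thesis using nn' by linarith
      qed
    next
      case 2
      have "U powr A * V powr B \<le> U powr 1 * 1"
        using AB UV 2 by (intro mult_mono powr_mono) (auto simp: powr_le1)
      then have "W powr D * (U powr A * V powr B) \<le> W * U"
        using WD UV W by (intro mult_mono) auto
      then show ?thesis using nn' by (simp add: mult.commute)
    next
      case 3
      have "U powr A * V powr B \<le> 1 * V powr 1"
        using AB UV 3 by (intro mult_mono powr_mono) (auto simp: powr_le1)
      then have "W powr D * (U powr A * V powr B) \<le> W * V"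
        using WD UV W by (intro mult_mono) auto
      then show ?thesis using nn' by (simp add: mult.commute)
    next
      case 4
      define m where "m = max U V"
      have m: "0 < m" "m \<le> 1" using UV 4 by (auto simp: m_def)
      have "U powr A * V powr B \<le> m powr A * m powr B"
        using AB UV by (intro mult_mono powr_mono2) (auto simp: m_def)
      also have "\<dots> = m powr (A + B)" by (simp add: powr_add)
      also have "\<dots> \<le> m powr 1" using m AB by (intro powr_mono') auto
      finally have "W powr D * (U powr A * V powr B) \<le> W * m"
        using WD UV W m by (intro mult_mono) auto
      also have "\<dots> \<le> U * W + V * W" using nn' by (auto simp: m_def max_def mult.commute)
      finally show ?thesis using nn' by simp
    qed
    then show ?thesis using nn' by (simp add: pwUV pwW mult.assoc)
  qed
qed

text \<open>With S = A + B and m = max U V the left side is at most m^S W^D R^(-2e - (1 - S)). If W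
  <= 1, then W^D <= W^(1 - S), and the result is bounded by a weighted geometric mean of m R^(-e)
  and W R^(-1-e). If W > 1, then W^D <= W, and the decay in R turns m^S into at most max m
  (R^(-1-e)).\<close>

lemma pw_prod_le_decay:
  fixes U V W A B D R e :: real
  assumes nn: "0 \<le> U" "0 \<le> V" "0 \<le> W"
    and AB: "0 \<le> A" "0 \<le> B" "A + B \<le> 1" "1 \<le> A + B + D"
    and D: "0 \<le> D" "D < 1" and R: "1 \<le> R" and e: "0 < e"
  shows "pw W D * pw U A * pw V B * R powr (- (2 * e + (1 - (A + B))))
    \<le> U * W + V * W + W * R powr (-1 - e) + U * R powr (-e) + V * R powr (-e)"
proof -
  define m where "m = max U V"
  define S where "S = A + B"
  have S: "0 < S" "S \<le> 1" "1 - S \<le> D" using AB D by (auto simp: S_def)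
  have m: "0 \<le> m" using nn by (simp add: m_def)
  have UV: "pw U A * pw V B \<le> m powr S"
  proof -
    have "pw U A * pw V B \<le> pw m A * pw m B"
      using AB nn by (intro mult_mono) (auto simp: m_def pw_def intro!: powr_mono2)
    also have "\<dots> = m powr S" using S AB by (auto simp: pw_def powr_add S_def)
    finally show ?thesis .
  qed
  have key: "m powr S * pw W D * R powr (- (2 * e + (1 - S))) \<le> m * W + max (W * R powr (-1 - e)) (m * R powr (-e))"
  proof (cases "W \<le> 1")
    case True
    have "pw W D \<le> pw W (1 - S)"
      using True nn S D by (auto simp: pw_def powr_le1 intro!: powr_mono')
    then have "m powr S * pw W D * R powr (- (2 * e + (1 - S))) \<le> m powr S * pw W (1 - S) * R powr (- (2 * e + (1 - S)))"
      by (intro mult_right_mono mult_left_mono) auto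
    \<comment> \<open>One e is given up; the remaining exponent is (-e) S + (-1 - e)(1 - S), as the
      geometric mean requires.\<close>
    also have "\<dots> \<le> m powr S * pw W (1 - S) * R powr (- (e + (1 - S)))"
      using e R by (intro mult_left_mono powr_mono) (auto simp: pw_nonneg)
    also have "\<dots> = (m * R powr (-e)) powr S * pw (W * R powr (-1 - e)) (1 - S)"
    proof -
      have "R powr (- (e + (1 - S))) = R powr ((-e) * S) * R powr ((-1 - e) * (1 - S))"
        by (simp add: powr_add[symmetric] algebra_simps)
      then show ?thesis using R m nn
        by (auto simp: pw_def powr_mult powr_powr algebra_simps)
    qed
    also have "\<dots> \<le> max (m * R powr (-e)) (W * R powr (-1 - e))"
    \<comment> \<open>At S = 1 the second factor has exponent 0, where \<open>pw\<close> is 1 even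
      for W = 0 while \<open>powr\<close> would give 0; the interpolation with \<open>powr\<close>
      is therefore used only for S < 1.\<close>
    proof (cases "S = 1")
      case True then show ?thesis using m by (simp add: pw_def)
    next
      case False then show ?thesis using powr_interpolate_le_max[of "m * R powr (-e)" "W * R powr (-1 - e)" S] m nn S
        by (simp add: pw_def)
    qed
    finally show ?thesis using m nn by (smt (verit) max.commute mult_nonneg_nonneg)
  next
    case False
    then have W: "1 < W" by simp
    have "pw W D \<le> W" using powr_mono[of D 1 W] W D by (simp add: pw_def)
    moreover have "- (2 * e + (1 - S)) \<le> - ((1 + e) * (1 - S))"
      using e S mult_left_mono[of "1 - S" 2 e] by (simp add: algebra_simps)
    then have "R powr (- (2 * e + (1 - S))) \<le> R powr (- ((1 + e) * (1 - S)))"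
      using R by (intro powr_mono) auto
    ultimately have "m powr S * pw W D * R powr (- (2 * e + (1 - S))) \<le> m powr S * W * R powr (- ((1 + e) * (1 - S)))"
      using W by (intro mult_mono mult_left_mono) (auto simp: pw_nonneg)
    also have "\<dots> = W * (m powr S * (R powr (-1 - e)) powr (1 - S))"
      by (simp add: powr_powr algebra_simps)
    also have "\<dots> \<le> W * max m (R powr (-1 - e))"
      using W m S by (intro mult_left_mono powr_interpolate_le_max) auto
    also have "\<dots> \<le> m * W + max (W * R powr (-1 - e)) (m * R powr (-e))"
      using W m by (auto simp: max_def mult.commute add_increasing add_increasing2)
    finally show ?thesis .
  qed
  have "pw W D * pw U A * pw V B * R powr (- (2 * e + (1 - (A + B)))) =
      (pw U A * pw V B) * (pw W D * R powr (- (2 * e + (1 - S))))"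
    by (simp add: S_def ac_simps)
  also have "\<dots> \<le> m powr S * (pw W D * R powr (- (2 * e + (1 - S))))"
    using UV by (intro mult_right_mono) (auto simp: pw_nonneg)
  also have "\<dots> \<le> m * W + max (W * R powr (-1 - e)) (m * R powr (-e))"
    using key by (simp add: mult.assoc)
  also have "\<dots> \<le> U * W + V * W + W * R powr (-1 - e) + U * R powr (-e) + V * R powr (-e)"
  proof -
    have "0 \<le> U * W" "0 \<le> V * W" "0 \<le> W * R powr (-1 - e)" "0 \<le> U * R powr (-e)" "0 \<le> V * R powr (-e)"
      using nn by auto
    then show ?thesis by (auto simp: m_def max_def)
  qed
  finally show ?thesis .
qed

section \<open>Integrals of powers of the norm\<close>

lemma nn_integral_lborel_plus:
  fixes f :: "'a::euclidean_space \<Rightarrow> ennreal"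
  assumes [measurable]: "f \<in> borel_measurable borel"
  shows "(\<integral>\<^sup>+ x. f (c + x) \<partial>lborel) = (\<integral>\<^sup>+ x. f x \<partial>lborel)"
proof -
  have "(\<integral>\<^sup>+ x. f x \<partial>lborel) = (\<integral>\<^sup>+ x. f x \<partial>distr lborel borel ((+) c))"
    by (simp add: lborel_distr_plus)
  then show ?thesis by (simp add: nn_integral_distr)
qed

lemma lborel_distr_minus:
  "distr lborel borel (\<lambda>x. c - x) = (lborel :: 'a::euclidean_space measure)"
  using lborel_affine[of "-1" c] by (simp add: density_1)

lemma nn_integral_lborel_minus:
  fixes f :: "'a::euclidean_space \<Rightarrow> ennreal"
  assumes [measurable]: "f \<in> borel_measurable borel"
  shows "(\<integral>\<^sup>+ x. f (c - x) \<partial>lborel) = (\<integral>\<^sup>+ x. f x \<partial>lborel)"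
proof -
  have "(\<integral>\<^sup>+ x. f x \<partial>lborel) = (\<integral>\<^sup>+ x. f x \<partial>distr lborel borel (\<lambda>x. c - x))"
    by (simp add: lborel_distr_minus)
  then show ?thesis by (simp add: nn_integral_distr)
qed

lemma AE_lborel_minus:
  fixes P :: "'a::euclidean_space \<Rightarrow> bool"
  assumes "AE x in lborel. P x"
  shows "AE x in lborel. P (c - x)"
proof -
  have "AE x in distr lborel borel (\<lambda>x. c - x). P x"
    unfolding lborel_distr_minus by (rule assms)
  then show ?thesis by (rule AE_distrD[rotated]) simp
qed

section \<open>Dyadic decompositions of radial powers\<close>

lemma dyadic_bracket:
  fixes t :: real
  assumes "1 \<le> t"
  obtains k :: nat where "2 ^ k \<le> t" "t < 2 ^ Suc k"
proof -
  obtain m where m: "t < 2 ^ m" using real_arch_pow[of 2 t] by auto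
  define k where "k = (LEAST j. t < 2 ^ Suc j)"
  have "t < 2 ^ Suc m" using m power_increasing[of m "Suc m" "2::real"] by linarith
  then have k: "t < 2 ^ Suc k" unfolding k_def by (rule LeastI)
  have "2 ^ k \<le> t"
  proof (cases k)
    case 0 then show ?thesis using assms by simp
  next
    case (Suc j)
    then have "\<not> t < 2 ^ Suc j" using not_less_Least[of j "\<lambda>j. t < 2 ^ Suc j"] by (simp add: k_def)
    then show ?thesis using Suc by simp
  qed
  then show ?thesis using that k by blast
qed

lemma power_powr_swap: "((2::real) ^ k) powr c = (2 powr c) ^ k"
proof -
  have "((2::real) ^ k) powr c = (2 powr real k) powr c" by (simp only: powr_realpow)
  also have "\<dots> = (2 powr c) powr real k" by (simp only: powr_powr mult.commute)
  also have "\<dots> = (2 powr c) ^ k" by (rule powr_realpow) simp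
  finally show ?thesis .
qed

lemma cball_measurable [measurable]: "cball (c::'a::euclidean_space) r \<in> sets borel"
  by simp

lemma emeasure_cball_powr:
  fixes c :: "'a::euclidean_space"
  assumes "0 < r"
  shows "emeasure lborel (cball c r) = ennreal (unit_ball_vol (real DIM('a)) * r powr real DIM('a))"
  using assms by (simp add: emeasure_cball powr_realpow)

text \<open>On the k-th dyadic shell, of outer radius r_k = \<rho> / 2^k, the integrand is at most a
  constant times r_k^(\<eta> - n), and the ball of that radius has measure of order r_k^n. What
  remains is a geometric series of ratio 2^(-\<eta>), convergent because \<eta> > 0.\<close>

lemma nn_integral_cball_powr:
  fixes \<eta> :: real
  assumes \<eta>: "0 < \<eta>"
  defines "n \<equiv> real DIM('a::euclidean_space)"
  shows "\<exists>C\<ge>0. \<forall>\<rho>>0. (\<integral>\<^sup>+ x. ennreal (norm x powr (\<eta> - n)) * indicator {x. norm x \<le> \<rho>} (x::'a) \<partial>lborel)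
            \<le> ennreal (C * \<rho> powr \<eta>)"
proof -
  define w where "w = unit_ball_vol n"
  have w: "0 \<le> w" by (simp add: w_def n_def)
  have n: "0 < n" by (simp add: n_def)
  define g where "g = 2 powr (-\<eta>)"
  have g: "0 \<le> g" "g < 1" using \<eta> by (auto simp: g_def intro!: powr_less_one)
  have main: "(\<integral>\<^sup>+ x. ennreal (norm x powr (\<eta> - n)) * indicator {x. norm x \<le> \<rho>} (x::'a) \<partial>lborel)
            \<le> ennreal ((2 powr n * w / (1 - g)) * \<rho> powr \<eta>)" if \<rho>: "0 < \<rho>" for \<rho>
  proof -
    define r where "r k = \<rho> / 2 ^ k" for k :: nat
    have r: "0 < r k" for k using \<rho> by (simp add: r_def)
    define F where "F k x = ennreal (2 powr n * r k powr (\<eta> - n)) * indicator (cball 0 (r k)) x" for k and x :: 'a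
    have [measurable]: "F k \<in> borel_measurable lborel" for k unfolding F_def by measurable
    have pt: "ennreal (norm x powr (\<eta> - n)) * indicator {x. norm x \<le> \<rho>} x \<le> (\<Sum>k. F k x)" for x :: 'a
    proof (cases "x \<noteq> 0 \<and> norm x \<le> \<rho>")
      case True
      then have "1 \<le> \<rho> / norm x" by (simp add: field_simps)
      then obtain k where k: "2 ^ k \<le> \<rho> / norm x" "\<rho> / norm x < 2 ^ Suc k" by (rule dyadic_bracket)
      have x: "0 < norm x" using True by simp
      have xr: "norm x \<le> r k" "r k \<le> 2 * norm x" using k x by (auto simp: r_def field_simps)
      \<comment> \<open>The sign of \<eta> - n is unknown, so the two factors are bounded
        separately, one at each end of the shell; this costs the factor 2^n.\<close>
      have "norm x powr (\<eta> - n) = norm x powr \<eta> * norm x powr (-n)" by (simp add: powr_add[symmetric])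
      also have "\<dots> \<le> r k powr \<eta> * (r k / 2) powr (-n)"
        using xr x \<eta> n r[of k] by (intro mult_mono powr_mono2 powr_mono2') auto
      also have "\<dots> = 2 powr n * r k powr (\<eta> - n)"
        using r[of k] by (simp add: powr_divide powr_diff powr_minus field_simps)
      finally have "ennreal (norm x powr (\<eta> - n)) * indicator {x. norm x \<le> \<rho>} x \<le> F k x"
        using xr by (auto simp: F_def indicator_def intro!: ennreal_leI)
      also have "F k x = (\<Sum>k\<in>{k}. F k x)" by simp
      also have "\<dots> \<le> (\<Sum>k. F k x)" by (intro sum_le_suminf) auto
      finally show ?thesis .
    next
      case False
      then have "ennreal (norm x powr (\<eta> - n)) * indicator {x. norm x \<le> \<rho>} x = 0" by (auto simp: indicator_def)
      then show ?thesis by (simp only: zero_le)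
    qed
    have "(\<integral>\<^sup>+ x. ennreal (norm x powr (\<eta> - n)) * indicator {x. norm x \<le> \<rho>} (x::'a) \<partial>lborel)
        \<le> (\<integral>\<^sup>+ x. (\<Sum>k. F k x) \<partial>lborel)"
      by (intro nn_integral_mono pt)
    also have "\<dots> = (\<Sum>k. \<integral>\<^sup>+ x. F k x \<partial>lborel)"
      by (rule nn_integral_suminf) measurable
    also have "\<dots> = (\<Sum>k. ennreal (2 powr n * w * \<rho> powr \<eta> * g ^ k))"
    proof (intro suminf_cong)
      fix k
      have "(\<integral>\<^sup>+ x. F k x \<partial>lborel) = ennreal (2 powr n * r k powr (\<eta> - n)) * emeasure lborel (cball (0::'a) (r k))"
        unfolding F_def by (subst nn_integral_cmult_indicator) auto
      also have "\<dots> = ennreal (2 powr n * r k powr (\<eta> - n) * (w * r k powr n))"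
        using r[of k] w by (simp add: emeasure_cball_powr ennreal_mult w_def n_def)
      also have "2 powr n * r k powr (\<eta> - n) * (w * r k powr n) = 2 powr n * w * r k powr \<eta>"
        using r[of k] by (simp add: powr_diff)
      also have "r k powr \<eta> = \<rho> powr \<eta> * g ^ k"
        using \<rho> by (simp add: r_def g_def powr_divide power_powr_swap powr_minus_divide power_divide)
      finally show "(\<integral>\<^sup>+ x. F k x \<partial>lborel) = ennreal (2 powr n * w * \<rho> powr \<eta> * g ^ k)"
        by (simp add: mult.assoc)
    qed
    also have "\<dots> = ennreal (2 powr n * w * \<rho> powr \<eta> * (1 / (1 - g)))"
      using g w by (intro suminf_ennreal_eq sums_mult geometric_sums) auto
    also have "\<dots> = ennreal ((2 powr n * w / (1 - g)) * \<rho> powr \<eta>)" by (simp add: field_simps)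
    finally show ?thesis .
  qed
  show ?thesis
    using main w g by (intro exI[of _ "2 powr n * w / (1 - g)"]) auto
qed

text \<open>The same decomposition with radii growing to infinity. The exponent is negative, so the
  value at the inner radius of a shell bounds the integrand, and 2^n comes from the ball of doubled
  radius.\<close>

lemma nn_integral_outside_powr:
  fixes \<eta> :: real
  assumes \<eta>: "0 < \<eta>"
  defines "n \<equiv> real DIM('a::euclidean_space)"
  shows "\<exists>C\<ge>0. \<forall>\<rho>>0. (\<integral>\<^sup>+ x. ennreal (norm x powr (- \<eta> - n)) * indicator {x. \<rho> \<le> norm x} (x::'a) \<partial>lborel)
            \<le> ennreal (C * \<rho> powr (- \<eta>))"
proof -
  define w where "w = unit_ball_vol n"
  have w: "0 \<le> w" by (simp add: w_def n_def)
  have n: "0 < n" by (simp add: n_def)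
  define g where "g = 2 powr (-\<eta>)"
  have g: "0 \<le> g" "g < 1" using \<eta> by (auto simp: g_def intro!: powr_less_one)
  have main: "(\<integral>\<^sup>+ x. ennreal (norm x powr (- \<eta> - n)) * indicator {x. \<rho> \<le> norm x} (x::'a) \<partial>lborel)
            \<le> ennreal ((2 powr n * w / (1 - g)) * \<rho> powr (-\<eta>))" if \<rho>: "0 < \<rho>" for \<rho>
  proof -
    define r where "r k = \<rho> * 2 ^ k" for k :: nat
    have r: "0 < r k" for k using \<rho> by (simp add: r_def)
    define F where "F k x = ennreal (r k powr (- \<eta> - n)) * indicator (cball 0 (2 * r k)) x" for k and x :: 'a
    have [measurable]: "F k \<in> borel_measurable lborel" for k unfolding F_def by measurable
    have pt: "ennreal (norm x powr (- \<eta> - n)) * indicator {x. \<rho> \<le> norm x} x \<le> (\<Sum>k. F k x)" for x :: 'a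
    proof (cases "\<rho> \<le> norm x")
      case True
      then have "1 \<le> norm x / \<rho>" using \<rho> by (simp add: field_simps)
      then obtain k where k: "2 ^ k \<le> norm x / \<rho>" "norm x / \<rho> < 2 ^ Suc k" by (rule dyadic_bracket)
      have xr: "r k \<le> norm x" "norm x \<le> 2 * r k" using k \<rho> by (auto simp: r_def field_simps)
      have "norm x powr (- \<eta> - n) \<le> r k powr (- \<eta> - n)"
        using xr \<eta> n r[of k] by (intro powr_mono2') auto
      then have "ennreal (norm x powr (- \<eta> - n)) * indicator {x. \<rho> \<le> norm x} x \<le> F k x"
        using xr by (auto simp: F_def indicator_def intro!: ennreal_leI)
      also have "F k x = (\<Sum>k\<in>{k}. F k x)" by simp
      also have "\<dots> \<le> (\<Sum>k. F k x)" by (intro sum_le_suminf) auto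
      finally show ?thesis .
    qed simp
    have "(\<integral>\<^sup>+ x. ennreal (norm x powr (- \<eta> - n)) * indicator {x. \<rho> \<le> norm x} (x::'a) \<partial>lborel)
        \<le> (\<integral>\<^sup>+ x. (\<Sum>k. F k x) \<partial>lborel)"
      by (intro nn_integral_mono pt)
    also have "\<dots> = (\<Sum>k. \<integral>\<^sup>+ x. F k x \<partial>lborel)"
      by (rule nn_integral_suminf) measurable
    also have "\<dots> = (\<Sum>k. ennreal (2 powr n * w * \<rho> powr (-\<eta>) * g ^ k))"
    proof (intro suminf_cong)
      fix k
      have "(\<integral>\<^sup>+ x. F k x \<partial>lborel) = ennreal (r k powr (- \<eta> - n)) * emeasure lborel (cball (0::'a) (2 * r k))"
        unfolding F_def by (subst nn_integral_cmult_indicator) auto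
      also have "\<dots> = ennreal (r k powr (- \<eta> - n) * (w * (2 * r k) powr n))"
        using r[of k] w by (subst emeasure_cball_powr) (auto simp: ennreal_mult w_def n_def)
      also have "r k powr (- \<eta> - n) * (w * (2 * r k) powr n) = 2 powr n * w * r k powr (-\<eta>)"
        using r[of k] by (simp add: powr_diff powr_mult)
      also have "r k powr (-\<eta>) = \<rho> powr (-\<eta>) * g ^ k"
        using \<rho> by (simp add: r_def g_def powr_mult power_powr_swap)
      finally show "(\<integral>\<^sup>+ x. F k x \<partial>lborel) = ennreal (2 powr n * w * \<rho> powr (-\<eta>) * g ^ k)"
        by (simp add: mult.assoc)
    qed
    also have "\<dots> = ennreal (2 powr n * w * \<rho> powr (-\<eta>) * (1 / (1 - g)))"
      using g w by (intro suminf_ennreal_eq sums_mult geometric_sums) auto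
    also have "\<dots> = ennreal ((2 powr n * w / (1 - g)) * \<rho> powr (-\<eta>))" by (simp add: field_simps)
    finally show ?thesis .
  qed
  show ?thesis
    using main w g by (intro exI[of _ "2 powr n * w / (1 - g)"]) auto
qed

text \<open>A dilation of x would remove G, so one constant serves all G. Instead of dilating, the
  integral is split at the radius that belongs to G, and the powers of G cancel on either
  side.\<close>

lemma nn_integral_bump:
  fixes e :: real
  assumes e: "0 < e"
  defines "n \<equiv> real DIM('a::euclidean_space)"
  shows "\<exists>C\<ge>0. \<forall>G>0. (\<integral>\<^sup>+ x. ennreal (norm x powr (- n) * bump e (norm (x::'a) powr n * G)) \<partial>lborel) \<le> ennreal C"
proof -
  have n: "0 < n" by (simp add: n_def)
  have ne: "0 < n * e" using n e by simp
  obtain C1 where C1: "0 \<le> C1" "\<And>\<rho>. \<rho> > 0 \<Longrightarrow> (\<integral>\<^sup>+ x. ennreal (norm x powr (n * e - n)) * indicator {x. norm x \<le> \<rho>} (x::'a) \<partial>lborel)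
            \<le> ennreal (C1 * \<rho> powr (n * e))"
    using nn_integral_cball_powr[OF ne, where 'a='a] unfolding n_def by blast
  obtain C2 where C2: "0 \<le> C2" "\<And>\<rho>. \<rho> > 0 \<Longrightarrow> (\<integral>\<^sup>+ x. ennreal (norm x powr (- (n * e) - n)) * indicator {x. \<rho> \<le> norm x} (x::'a) \<partial>lborel)
            \<le> ennreal (C2 * \<rho> powr (-(n * e)))"
    using nn_integral_outside_powr[OF ne, where 'a='a] unfolding n_def by blast
  have main: "(\<integral>\<^sup>+ x. ennreal (norm x powr (- n) * bump e (norm (x::'a) powr n * G)) \<partial>lborel) \<le> ennreal (C1 + C2)"
    if G: "0 < G" for G
  proof -
    \<comment> \<open>The radius at which \<open>norm x powr n * G\<close> equals 1 and the two
      branches of \<open>bump\<close> change over.\<close>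
    define \<rho> where "\<rho> = G powr (- (1 / n))"
    have \<rho>: "0 < \<rho>" using G by (simp add: \<rho>_def)
    have \<rho>n: "\<rho> powr (n * e) = G powr (-e)" "\<rho> powr (- (n * e)) = G powr e"
      using n by (auto simp: \<rho>_def powr_powr)
    have pt: "ennreal (norm x powr (- n) * bump e (norm x powr n * G)) \<le>
       ennreal (G powr e) * (ennreal (norm x powr (n * e - n)) * indicator {x. norm x \<le> \<rho>} x) +
       ennreal (G powr (-e)) * (ennreal (norm x powr (- (n * e) - n)) * indicator {x. \<rho> \<le> norm x} x)" for x :: 'a
    proof (cases "x = 0")
      case False
      then have x: "0 < norm x" by simp
      have 1: "norm x powr (- n) * bump e (norm x powr n * G) \<le> G powr e * norm x powr (n * e - n)"
      proof -
        have "norm x powr (- n) * bump e (norm x powr n * G) \<le> norm x powr (- n) * (norm x powr n * G) powr e"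
          by (intro mult_left_mono) (auto simp: bump_def)
        also have "\<dots> = G powr e * norm x powr (n * e - n)"
          using x G by (simp add: powr_mult powr_powr powr_diff powr_minus field_simps)
        finally show ?thesis .
      qed
      have 2: "norm x powr (- n) * bump e (norm x powr n * G) \<le> G powr (-e) * norm x powr (- (n * e) - n)"
      proof -
        have "norm x powr (- n) * bump e (norm x powr n * G) \<le> norm x powr (- n) * (norm x powr n * G) powr (-e)"
          by (intro mult_left_mono) (auto simp: bump_def)
        also have "\<dots> = G powr (-e) * norm x powr (- (n * e) - n)"
          using x G by (simp add: powr_mult powr_powr powr_diff powr_minus field_simps)
        finally show ?thesis .
      qed
      show ?thesis
      proof (cases "norm x \<le> \<rho>")
        case True
        have "ennreal (norm x powr (- n) * bump e (norm x powr n * G)) \<le> ennreal (G powr e) * (ennreal (norm x powr (n * e - n)) * indicator {x. norm x \<le> \<rho>} x)"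
          using 1 True by (simp add: ennreal_mult[symmetric] ennreal_leI)
        then show ?thesis by (rule order_trans) simp
      next
        case False
        have "ennreal (norm x powr (- n) * bump e (norm x powr n * G)) \<le> ennreal (G powr (-e)) * (ennreal (norm x powr (- (n * e) - n)) * indicator {x. \<rho> \<le> norm x} x)"
          using 2 False by (simp add: ennreal_mult[symmetric] ennreal_leI)
        then show ?thesis by (rule order_trans) simp
      qed
    qed simp
    have "(\<integral>\<^sup>+ x. ennreal (norm x powr (- n) * bump e (norm (x::'a) powr n * G)) \<partial>lborel)
      \<le> (\<integral>\<^sup>+ x. ennreal (G powr e) * (ennreal (norm x powr (n * e - n)) * indicator {x. norm x \<le> \<rho>} x) +
       ennreal (G powr (-e)) * (ennreal (norm x powr (- (n * e) - n)) * indicator {x. \<rho> \<le> norm x} x) \<partial>(lborel :: 'a measure))"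
      by (intro nn_integral_mono pt)
    also have "\<dots> = ennreal (G powr e) * (\<integral>\<^sup>+ x. ennreal (norm x powr (n * e - n)) * indicator {x. norm x \<le> \<rho>} (x::'a) \<partial>lborel)
      + ennreal (G powr (-e)) * (\<integral>\<^sup>+ x. ennreal (norm x powr (- (n * e) - n)) * indicator {x. \<rho> \<le> norm x} (x::'a) \<partial>lborel)"
      by (subst nn_integral_add, measurable, subst nn_integral_cmult, measurable, subst nn_integral_cmult, measurable)
    also have "\<dots> \<le> ennreal (G powr e) * ennreal (C1 * \<rho> powr (n * e)) + ennreal (G powr (-e)) * ennreal (C2 * \<rho> powr (-(n * e)))"
      using C1(2)[OF \<rho>] C2(2)[OF \<rho>] by (intro add_mono mult_left_mono) auto
    also have "ennreal (G powr e) * ennreal (C1 * \<rho> powr (n * e)) = ennreal C1"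
      using G C1(1) by (subst ennreal_mult[symmetric]) (auto simp: \<rho>n powr_minus)
    also have "ennreal (G powr (-e)) * ennreal (C2 * \<rho> powr (-(n * e))) = ennreal C2"
      using G C2(1) by (subst ennreal_mult[symmetric]) (auto simp: \<rho>n powr_minus)
    also have "ennreal C1 + ennreal C2 = ennreal (C1 + C2)" using C1(1) C2(1) by simp
    finally show ?thesis .
  qed
  show ?thesis using main C1 C2 by (intro exI[of _ "C1 + C2"]) auto
qed

section \<open>The trilinear form\<close>

definition unit_density :: "('a::euclidean_space \<Rightarrow> real) \<Rightarrow> bool" where
  "unit_density E \<longleftrightarrow> E \<in> borel_measurable borel \<and> (\<forall>x. 0 \<le> E x) \<and> (\<integral>\<^sup>+ x. ennreal (E x) \<partial>lborel) \<le> 1"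

lemma unit_densityD:
  assumes "unit_density E"
  shows "E \<in> borel_measurable borel" "\<And>x. 0 \<le> E x" "(\<integral>\<^sup>+ x. ennreal (E x) \<partial>lborel) \<le> 1"
  using assms by (auto simp: unit_density_def)

lemma borel_measurable_pw [measurable]:
  "f \<in> borel_measurable M \<Longrightarrow> (\<lambda>x. pw (f x) k) \<in> borel_measurable M"
  by (cases "k = 0") (auto simp: pw_def)

lemma borel_measurable_bump [measurable]:
  assumes [measurable]: "f \<in> borel_measurable M"
  shows "(\<lambda>x. bump e (f x)) \<in> borel_measurable M"
  unfolding bump_def by measurable

text \<open>Tonelli, integrating the kernel first. Its bound is asked only where E is positive,
  because the kernel may itself contain \<open>bump e (norm x powr n * E y)\<close> and
  \<open>nn_integral_bump\<close> wants a positive parameter; where E vanishes the product is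
  zero.\<close>

lemma nn_integral_density_kernel:
  fixes E :: "'a::euclidean_space \<Rightarrow> real" and k :: "'a \<Rightarrow> 'a \<Rightarrow> ennreal"
  assumes E: "unit_density E"
    and [measurable]: "(\<lambda>(x, y). k x y) \<in> borel_measurable (borel \<Otimes>\<^sub>M borel)"
    and k: "\<And>y. 0 < E y \<Longrightarrow> (\<integral>\<^sup>+ x. k x y \<partial>lborel) \<le> C"
  shows "(\<integral>\<^sup>+ x. \<integral>\<^sup>+ y. ennreal (E y) * k x y \<partial>lborel \<partial>lborel) \<le> C"
proof -
  note [measurable] = unit_densityD(1)[OF E]
  have "(\<integral>\<^sup>+ x. \<integral>\<^sup>+ y. ennreal (E y) * k x y \<partial>lborel \<partial>lborel) =
        (\<integral>\<^sup>+ y. \<integral>\<^sup>+ x. ennreal (E y) * k x y \<partial>lborel \<partial>lborel)"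
    by (rule lborel_pair.Fubini'[symmetric]) measurable
  also have "\<dots> = (\<integral>\<^sup>+ y. ennreal (E y) * (\<integral>\<^sup>+ x. k x y \<partial>lborel) \<partial>lborel)"
    by (rule nn_integral_cong, rule nn_integral_cmult) measurable
  also have "\<dots> \<le> (\<integral>\<^sup>+ y. ennreal (E y) * C \<partial>lborel)"
  proof (rule nn_integral_mono)
    fix y
    show "ennreal (E y) * (\<integral>\<^sup>+ x. k x y \<partial>lborel) \<le> ennreal (E y) * C"
      using k[of y] unit_densityD(2)[OF E, of y] by (cases "E y = 0") (auto intro!: mult_left_mono)
  qed
  also have "\<dots> = (\<integral>\<^sup>+ y. ennreal (E y) \<partial>lborel) * C"
    by (rule nn_integral_multc) measurable
  also have "\<dots> \<le> 1 * C" by (intro mult_right_mono unit_densityD(3)[OF E]) simp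
  finally show ?thesis by simp
qed

text \<open>For fixed x the inner variable is translated by x; this version handles the density at
  the third point x + y.\<close>

lemma nn_integral_density_kernel_shift:
  fixes E :: "'a::euclidean_space \<Rightarrow> real" and k :: "'a \<Rightarrow> 'a \<Rightarrow> ennreal"
  assumes E: "unit_density E"
    and m[measurable]: "(\<lambda>(x, y). k x y) \<in> borel_measurable (borel \<Otimes>\<^sub>M borel)"
    and k: "\<And>y. 0 < E y \<Longrightarrow> (\<integral>\<^sup>+ x. k x y \<partial>lborel) \<le> C"
  shows "(\<integral>\<^sup>+ x. \<integral>\<^sup>+ y. ennreal (E (x + y)) * k x (x + y) \<partial>lborel \<partial>lborel) \<le> C"
proof -
  note [measurable] = unit_densityD(1)[OF E]
  have "(\<integral>\<^sup>+ y. ennreal (E (x + y)) * k x (x + y) \<partial>lborel) = (\<integral>\<^sup>+ y. ennreal (E y) * k x y \<partial>lborel)" for x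
    by (rule nn_integral_lborel_plus[where f = "\<lambda>y. ennreal (E y) * k x y"]) measurable
  then show ?thesis using nn_integral_density_kernel[OF E m k] by simp
qed

lemma powr_comparable:
  fixes y z c :: real
  assumes "0 < y" "z \<le> 2 * y" "y \<le> 2 * z"
  shows "z powr c \<le> 2 powr \<bar>c\<bar> * y powr c"
proof (cases "0 \<le> c")
  case True
  have "z powr c \<le> (2 * y) powr c" using assms True by (intro powr_mono2) auto
  then show ?thesis using True assms by (simp add: powr_mult)
next
  case False
  have "z powr c \<le> (y / 2) powr c" using assms False by (intro powr_mono2') auto
  also have "(y / 2) powr c = y powr c / 2 powr c" by (rule powr_divide)
  also have "\<dots> = 2 powr \<bar>c\<bar> * y powr c" using False by (simp add: powr_minus_divide abs_if)
  finally show ?thesis .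
qed

text \<open>Both regimes of the pointwise estimate end in five dominating terms, so their integrals
  are summed here once. The null set x = 0 is left out of the pointwise hypothesis because the
  rescaling divides by the norm of x.\<close>

lemma nn_integral2_five_terms:
  fixes f T1 T2 T3 T4 T5 :: "'a::euclidean_space \<Rightarrow> 'a \<Rightarrow> ennreal"
  assumes le: "\<And>x y. x \<noteq> 0 \<Longrightarrow> f x y \<le> ennreal c * (T1 x y + T2 x y + T3 x y + T4 x y + T5 x y)"
    and [measurable]: "case_prod T1 \<in> borel_measurable (borel \<Otimes>\<^sub>M borel)"
      "case_prod T2 \<in> borel_measurable (borel \<Otimes>\<^sub>M borel)"
      "case_prod T3 \<in> borel_measurable (borel \<Otimes>\<^sub>M borel)"
      "case_prod T4 \<in> borel_measurable (borel \<Otimes>\<^sub>M borel)"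
      "case_prod T5 \<in> borel_measurable (borel \<Otimes>\<^sub>M borel)"
    and I: "(\<integral>\<^sup>+ x. \<integral>\<^sup>+ y. T1 x y \<partial>lborel \<partial>lborel) \<le> ennreal c1"
      "(\<integral>\<^sup>+ x. \<integral>\<^sup>+ y. T2 x y \<partial>lborel \<partial>lborel) \<le> ennreal c2"
      "(\<integral>\<^sup>+ x. \<integral>\<^sup>+ y. T3 x y \<partial>lborel \<partial>lborel) \<le> ennreal c3"
      "(\<integral>\<^sup>+ x. \<integral>\<^sup>+ y. T4 x y \<partial>lborel \<partial>lborel) \<le> ennreal c4"
      "(\<integral>\<^sup>+ x. \<integral>\<^sup>+ y. T5 x y \<partial>lborel \<partial>lborel) \<le> ennreal c5"
    and nn: "0 \<le> c" "0 \<le> c1" "0 \<le> c2" "0 \<le> c3" "0 \<le> c4" "0 \<le> c5"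
  shows "(\<integral>\<^sup>+ x. \<integral>\<^sup>+ y. f x y \<partial>lborel \<partial>lborel) \<le> ennreal (c * (c1 + c2 + c3 + c4 + c5))"
proof -
  have "(\<integral>\<^sup>+ x. \<integral>\<^sup>+ y. f x y \<partial>lborel \<partial>lborel) \<le>
     (\<integral>\<^sup>+ x. \<integral>\<^sup>+ y. ennreal c * (T1 x y + T2 x y + T3 x y + T4 x y + T5 x y) \<partial>lborel \<partial>lborel)"
    using AE_lborel_singleton[of "0::'a"]
    by (intro nn_integral_mono_AE) (auto elim!: eventually_mono intro!: nn_integral_mono le)
  also have "\<dots> = ennreal c * ((\<integral>\<^sup>+ x. \<integral>\<^sup>+ y. T1 x y \<partial>lborel \<partial>lborel) + (\<integral>\<^sup>+ x. \<integral>\<^sup>+ y. T2 x y \<partial>lborel \<partial>lborel)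
     + (\<integral>\<^sup>+ x. \<integral>\<^sup>+ y. T3 x y \<partial>lborel \<partial>lborel) + (\<integral>\<^sup>+ x. \<integral>\<^sup>+ y. T4 x y \<partial>lborel \<partial>lborel)
     + (\<integral>\<^sup>+ x. \<integral>\<^sup>+ y. T5 x y \<partial>lborel \<partial>lborel))"
    by (simp add: nn_integral_cmult nn_integral_add)
  also have "\<dots> \<le> ennreal c * (ennreal c1 + ennreal c2 + ennreal c3 + ennreal c4 + ennreal c5)"
    by (intro mult_left_mono add_mono I) simp
  also have "\<dots> = ennreal (c * (c1 + c2 + c3 + c4 + c5))"
    using nn by (simp add: ennreal_mult)
  finally show ?thesis .
qed

text \<open>The points x, y, x + y carry the weights a, b, c and the density powers D, A, B in this
  order. The first slot is meant for the point of smallest norm; moving another point there permutes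
  the parameters and, in one case, reflects a density.\<close>

definition trilinear_form ::
  "real \<Rightarrow> real \<Rightarrow> real \<Rightarrow> real \<Rightarrow> real \<Rightarrow> real \<Rightarrow> ('a::euclidean_space \<Rightarrow> real) \<Rightarrow> ('a \<Rightarrow> real) \<Rightarrow> ('a \<Rightarrow> real) \<Rightarrow> 'a \<Rightarrow> 'a \<Rightarrow> real" where
  "trilinear_form a b c D A B E1 E2 E3 x y =
     norm x powr (-a) * pw (E1 x) D * (norm y powr (-b) * pw (E2 y) A) * (norm (x + y) powr (-c) * pw (E3 (x + y)) B)"

text \<open>As x is smallest, the norms of y and x + y differ by a factor of at most 2, so the third
  weight is moved to y. The rest is an identity: with X = \<open>norm x powr n\<close>, scaling says
  that X^(-2 + D + A + B) times |x|^(b + c) is |x|^(-a).\<close>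

lemma trilinear_form_rescale:
  fixes x y :: "'a::euclidean_space"
  defines "n \<equiv> real DIM('a)"
  assumes x: "x \<noteq> 0" "norm x \<le> norm y" "norm x \<le> norm (x + y)"
    and E: "0 \<le> E1 x" "0 \<le> E2 y" "0 \<le> E3 (x + y)"
    and scal: "A + B + D + (a + b + c) / n = 2"
  shows "trilinear_form a b c D A B E1 E2 E3 x y \<le> 2 powr \<bar>c\<bar> * (norm x powr (- (2 * n)) *
     (pw (norm x powr n * E1 x) D * pw (norm x powr n * E2 y) A * pw (norm x powr n * E3 (x + y)) B *
      ((norm y / norm x) powr n) powr (- ((b + c) / n))))"
proof -
  have n: "0 < n" by (simp add: n_def)
  have nx: "0 < norm x" and ny: "0 < norm y" using x by (auto intro: less_le_trans)
  have "norm (x + y) powr (-c) \<le> 2 powr \<bar>-c\<bar> * norm y powr (-c)"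
  proof (rule powr_comparable)
    show "norm (x + y) \<le> 2 * norm y" using norm_triangle_ineq[of x y] x by linarith
    show "norm y \<le> 2 * norm (x + y)" using norm_triangle_ineq4[of "x + y" x] x by simp
  qed (rule ny)
  then have "trilinear_form a b c D A B E1 E2 E3 x y \<le>
      norm x powr (-a) * pw (E1 x) D * (norm y powr (-b) * pw (E2 y) A) * ((2 powr \<bar>c\<bar> * norm y powr (-c)) * pw (E3 (x + y)) B)"
    unfolding trilinear_form_def by (intro mult_left_mono mult_right_mono) (auto simp: pw_nonneg)
  also have "\<dots> = 2 powr \<bar>c\<bar> * (norm x powr (-a) * norm y powr (- (b + c)) * (pw (E1 x) D * pw (E2 y) A * pw (E3 (x + y)) B))"
    using powr_add[of "norm y" "-b" "-c"] by (simp add: ac_simps)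
  also have "norm x powr (-a) * norm y powr (- (b + c)) * (pw (E1 x) D * pw (E2 y) A * pw (E3 (x + y)) B) =
     norm x powr (- (2 * n)) *
     (pw (norm x powr n * E1 x) D * pw (norm x powr n * E2 y) A * pw (norm x powr n * E3 (x + y)) B *
      ((norm y / norm x) powr n) powr (- ((b + c) / n)))"
  proof -
    have 1: "((norm y / norm x) powr n) powr (- ((b + c) / n)) = norm y powr (- (b + c)) * norm x powr (b + c)"
    proof -
      have "n * (- ((b + c) / n)) = - (b + c)" using n by simp
      then have "((norm y / norm x) powr n) powr (- ((b + c) / n)) = (norm y / norm x) powr (- (b + c))"
        by (simp only: powr_powr)
      also have "\<dots> = norm y powr (- (b + c)) / norm x powr (- (b + c))"
        by (rule powr_divide)
      finally show ?thesis by (simp only: powr_minus divide_inverse inverse_inverse_eq)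
    qed
    have s: "- (2 * n) + n * D + n * A + n * B + (b + c) = -a"
      using scal n by (simp add: field_simps)
    have 2: "norm x powr (- (2 * n)) * (norm x powr n) powr D * (norm x powr n) powr A * (norm x powr n) powr B * norm x powr (b + c)
         = norm x powr (-a)"
      unfolding powr_powr powr_add[symmetric] s ..
    have X: "0 < norm x powr n" using nx by simp
    show ?thesis
      unfolding 2[symmetric] 1 pw_mult[OF X E(1)] pw_mult[OF X E(2)] pw_mult[OF X E(3)]
      by (simp only: ac_simps)
  qed
  finally show ?thesis .
qed

text \<open>Any two of x, y, x + y are volume preserving coordinates on the product space, so a
  product of two densities integrates to at most 1.\<close>

lemma nn_integral_pair_product:
  fixes E F :: "'a::euclidean_space \<Rightarrow> real"
  assumes E: "unit_density E" and F: "unit_density F"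
  shows "(\<integral>\<^sup>+ x. \<integral>\<^sup>+ y. ennreal (E x * F y) \<partial>lborel \<partial>lborel) \<le> ennreal 1"
    "(\<integral>\<^sup>+ x. \<integral>\<^sup>+ y. ennreal (E x * F (x + y)) \<partial>lborel \<partial>lborel) \<le> ennreal 1"
    "(\<integral>\<^sup>+ x. \<integral>\<^sup>+ y. ennreal (E y * F (x + y)) \<partial>lborel \<partial>lborel) \<le> ennreal 1"
proof -
  note [measurable] = unit_densityD(1)[OF E] unit_densityD(1)[OF F]
  note nn = unit_densityD(2)[OF E] unit_densityD(2)[OF F]
  show "(\<integral>\<^sup>+ x. \<integral>\<^sup>+ y. ennreal (E x * F y) \<partial>lborel \<partial>lborel) \<le> ennreal 1"
    using nn_integral_density_kernel[OF F, of "\<lambda>x y. ennreal (E x)" 1] unit_densityD(3)[OF E] nn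
    by (simp add: ennreal_mult mult.commute)
  show "(\<integral>\<^sup>+ x. \<integral>\<^sup>+ y. ennreal (E x * F (x + y)) \<partial>lborel \<partial>lborel) \<le> ennreal 1"
    using nn_integral_density_kernel_shift[OF F, of "\<lambda>x y. ennreal (E x)" 1] unit_densityD(3)[OF E] nn
    by (simp add: ennreal_mult mult.commute)
  have "(\<integral>\<^sup>+ x. ennreal (F (x + y)) \<partial>lborel) \<le> 1" for y
    using nn_integral_lborel_plus[of "\<lambda>x. ennreal (F x)" y] unit_densityD(3)[OF F] by (simp add: add.commute)
  then show "(\<integral>\<^sup>+ x. \<integral>\<^sup>+ y. ennreal (E y * F (x + y)) \<partial>lborel \<partial>lborel) \<le> ennreal 1"
    using nn_integral_density_kernel[OF E, of "\<lambda>x y. ennreal (F (x + y))" 1] nn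
    by (simp add: ennreal_mult)
qed

section \<open>The region where the first point is smallest\<close>

definition smallest_first :: "'a::euclidean_space \<Rightarrow> 'a set" where
  "smallest_first x = {y. norm x \<le> norm y \<and> norm x \<le> norm (x + y)}"

text \<open>As R >= 1 and b + c >= 0, the power of R is at most 1 and is dropped. Multiplied by
  X^(-2), the five terms of \<open>pw_prod_le_pairs\<close> become three products of two densities
  and two densities times a kernel X^(-1) \<open>bump e\<close> (X E). The gain comes from the
  Lebesgue exponents alone, which is why b + c = 0 is allowed.\<close>

lemma trilinear_smallest_large:
  fixes a b c A B D :: real
  defines "n \<equiv> real DIM('a::euclidean_space)"
  assumes A: "A < 1" and B: "B < 1" and D: "0 \<le> D" "D < 1" and AB: "1 < A + B"
    and scal: "A + B + D + (a + b + c) / n = 2" and sum: "0 \<le> a + b + c" and bc: "0 \<le> b + c"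
  shows "\<exists>C\<ge>0. \<forall>E1 E2 E3 :: 'a \<Rightarrow> real. unit_density E1 \<and> unit_density E2 \<and> unit_density E3 \<longrightarrow>
    (\<integral>\<^sup>+ x. \<integral>\<^sup>+ y. ennreal (trilinear_form a b c D A B E1 E2 E3 x y) * indicator (smallest_first x) y \<partial>lborel \<partial>lborel) \<le> ennreal C"
proof -
  have n: "0 < n" by (simp add: n_def)
  \<comment> \<open>The largest margin that the three strict inequalities on A and B leave.\<close>
  define e where "e = min (1 - A) (min (1 - B) (A + B - 1))"
  have e: "0 < e" "A \<le> 1 - e" "B \<le> 1 - e" "1 + e \<le> A + B" using A B AB by (auto simp: e_def)
  have pos: "0 < A" "0 < B" using A B AB by auto
  \<comment> \<open>The scaling identity turns the nonnegative sum of weights into the condition for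
    trading the smallest of three large factors.\<close>
  have ABD: "A + B + D \<le> 2" using scal sum n by (smt (verit) divide_nonneg_pos)
  obtain C0 where C0: "0 \<le> C0" "\<And>G. 0 < G \<Longrightarrow> (\<integral>\<^sup>+ x. ennreal (norm x powr (- n) * bump e (norm (x::'a) powr n * G)) \<partial>lborel) \<le> ennreal C0"
    using nn_integral_bump[OF e(1), where 'a='a] unfolding n_def by blast
  have "(\<integral>\<^sup>+ x. \<integral>\<^sup>+ y. ennreal (trilinear_form a b c D A B E1 E2 E3 x y) * indicator (smallest_first x) y \<partial>lborel \<partial>lborel)
      \<le> ennreal (2 powr \<bar>c\<bar> * (1 + 1 + 1 + C0 + C0))"
    if E: "unit_density E1" "unit_density E2" "unit_density E3" for E1 E2 E3 :: "'a \<Rightarrow> real"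
  proof -
    note [measurable] = E[THEN unit_densityD(1)]
    note nn = E[THEN unit_densityD(2)]
    define k where "k G x = norm (x::'a) powr (- n) * bump e (norm x powr n * G)" for G x
    have k0: "0 \<le> k G x" for G x by (simp add: k_def bump_nonneg)
    have km [measurable]: "(\<lambda>(x, y). k (E y) x) \<in> borel_measurable (borel \<Otimes>\<^sub>M borel)"
      if [measurable]: "E \<in> borel_measurable borel" for E :: "'a \<Rightarrow> real"
      unfolding k_def by measurable
    show ?thesis
    proof (rule nn_integral2_five_terms[where
          ?T1.0 = "\<lambda>x y. ennreal (E2 y * E3 (x + y))" and
          ?T2.0 = "\<lambda>x y. ennreal (E1 x * E2 y)" and
          ?T3.0 = "\<lambda>x y. ennreal (E1 x * E3 (x + y))" and
          ?T4.0 = "\<lambda>x y. ennreal (E2 y) * ennreal (k (E2 y) x)" and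
          ?T5.0 = "\<lambda>x y. ennreal (E3 (x + y)) * ennreal (k (E3 (x + y)) x)"])
      fix x y :: 'a
      assume x: "x \<noteq> 0"
      show "ennreal (trilinear_form a b c D A B E1 E2 E3 x y) * indicator (smallest_first x) y
        \<le> ennreal (2 powr \<bar>c\<bar>) * (ennreal (E2 y * E3 (x + y)) + ennreal (E1 x * E2 y) + ennreal (E1 x * E3 (x + y)) +
          ennreal (E2 y) * ennreal (k (E2 y) x) + ennreal (E3 (x + y)) * ennreal (k (E3 (x + y)) x))"
      proof (cases "y \<in> smallest_first x")
        case True
        then have y: "norm x \<le> norm y" "norm x \<le> norm (x + y)" by (auto simp: smallest_first_def)
        have nx: "0 < norm x" using x by simp
        define X where "X = norm x powr n"
        have X: "0 < X" using x by (simp add: X_def)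
        have X2: "norm x powr (- (2 * n)) = inverse X * inverse X" "norm x powr (- n) = inverse X"
          by (auto simp: X_def powr_minus[symmetric] powr_add[symmetric])
        define R where "R = (norm y / norm x) powr n"
        have "1 \<le> R" unfolding R_def using y nx n by (intro ge_one_powr_ge_zero) auto
        then have R: "R powr (- ((b + c) / n)) \<le> 1"
          using bc n powr_mono[of "- ((b + c) / n)" 0 R] by simp
        define P where "P = pw (X * E1 x) D * pw (X * E2 y) A * pw (X * E3 (x + y)) B"
        have P0: "0 \<le> P" by (simp add: P_def pw_nonneg)
        have "trilinear_form a b c D A B E1 E2 E3 x y \<le> 2 powr \<bar>c\<bar> * (norm x powr (- (2 * n)) * (P * R powr (- ((b + c) / n))))"
          unfolding P_def X_def R_def n_def
          using trilinear_form_rescale[where ?E1.0 = E1 and ?E2.0 = E2 and ?E3.0 = E3, OF x y nn(1) nn(2) nn(3) scal[unfolded n_def]] .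
        also have "\<dots> \<le> 2 powr \<bar>c\<bar> * (norm x powr (- (2 * n)) * (P * 1))"
          using R P0 by (intro mult_left_mono) auto
        also have "P * 1 \<le> X * E2 y * (X * E3 (x + y)) + X * E2 y * (X * E1 x) + X * E3 (x + y) * (X * E1 x)
              + X * E2 y * bump e (X * E2 y) + X * E3 (x + y) * bump e (X * E3 (x + y))"
          unfolding P_def mult_1_right using X nn pos e D ABD
          by (intro pw_prod_le_pairs) auto
        also have "norm x powr (- (2 * n)) * \<dots> = E2 y * E3 (x + y) + E1 x * E2 y + E1 x * E3 (x + y) + E2 y * k (E2 y) x
              + E3 (x + y) * k (E3 (x + y)) x"
          unfolding k_def X_def[symmetric] X2 using X by (simp add: field_simps)
        finally have "trilinear_form a b c D A B E1 E2 E3 x y \<le> 2 powr \<bar>c\<bar> * (E2 y * E3 (x + y) + E1 x * E2 y + E1 x * E3 (x + y)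
            + E2 y * k (E2 y) x + E3 (x + y) * k (E3 (x + y)) x)"
          by (simp add: mult_left_mono)
        then have "ennreal (trilinear_form a b c D A B E1 E2 E3 x y) \<le> ennreal (2 powr \<bar>c\<bar> * (E2 y * E3 (x + y) + E1 x * E2 y + E1 x * E3 (x + y)
            + E2 y * k (E2 y) x + E3 (x + y) * k (E3 (x + y)) x))"
          by (rule ennreal_leI)
        also have "\<dots> = ennreal (2 powr \<bar>c\<bar>) * (ennreal (E2 y * E3 (x + y)) + ennreal (E1 x * E2 y) + ennreal (E1 x * E3 (x + y)) +
          ennreal (E2 y) * ennreal (k (E2 y) x) + ennreal (E3 (x + y)) * ennreal (k (E3 (x + y)) x))"
          using nn k0 by (simp add: ennreal_mult)
        finally show ?thesis using True by simp
      qed simp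
    next
      show "(\<integral>\<^sup>+ x. \<integral>\<^sup>+ y. ennreal (E2 y) * ennreal (k (E2 y) x) \<partial>lborel \<partial>lborel) \<le> ennreal C0"
        using C0(2) by (intro nn_integral_density_kernel E) (auto simp: k_def)
      show "(\<integral>\<^sup>+ x. \<integral>\<^sup>+ y. ennreal (E3 (x + y)) * ennreal (k (E3 (x + y)) x) \<partial>lborel \<partial>lborel) \<le> ennreal C0"
        using C0(2) by (intro nn_integral_density_kernel_shift[where k = "\<lambda>x y. ennreal (k (E3 y) x)"] E) (auto simp: k_def)
    qed (use C0(1) E in \<open>auto intro!: nn_integral_pair_product[unfolded ennreal_1] simp: k_def\<close>)
  qed
  then show ?thesis using C0(1) by (intro exI[of _ "2 powr \<bar>c\<bar> * (1 + 1 + 1 + C0 + C0)"]) auto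
qed

text \<open>The kernel X^(-1) R^(-e), with X = |x|^n and R = (|y|/|x|)^n, integrated over the
  smaller point x. For y = 0 the integrand vanishes, since \<open>0 powr\<close> anything is
  0.\<close>

lemma nn_integral_inner_kernel:
  fixes e :: real
  defines "n \<equiv> real DIM('a::euclidean_space)"
  assumes e: "0 < e"
  shows "\<exists>C\<ge>0. \<forall>y::'a. (\<integral>\<^sup>+ x. ennreal (norm x powr (n * e - n) * norm y powr (- (n * e))) * indicator {x. norm x \<le> norm y} (x::'a) \<partial>lborel) \<le> ennreal C"
proof -
  have ne: "0 < n * e" using e by (simp add: n_def)
  obtain C where C: "0 \<le> C" "\<And>\<rho>. \<rho> > 0 \<Longrightarrow> (\<integral>\<^sup>+ x. ennreal (norm x powr (n * e - n)) * indicator {x. norm x \<le> \<rho>} (x::'a) \<partial>lborel)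
            \<le> ennreal (C * \<rho> powr (n * e))"
    using nn_integral_cball_powr[OF ne, where 'a='a] unfolding n_def by blast
  have "(\<integral>\<^sup>+ x. ennreal (norm x powr (n * e - n) * norm y powr (- (n * e))) * indicator {x. norm x \<le> norm y} (x::'a) \<partial>lborel) \<le> ennreal C"
    for y :: 'a
  proof (cases "y = 0")
    case False
    have "(\<integral>\<^sup>+ x. ennreal (norm x powr (n * e - n) * norm y powr (- (n * e))) * indicator {x. norm x \<le> norm y} (x::'a) \<partial>lborel)
       = (\<integral>\<^sup>+ x. ennreal (norm y powr (- (n * e))) * (ennreal (norm x powr (n * e - n)) * indicator {x. norm x \<le> norm y} (x::'a)) \<partial>lborel)"
      by (intro nn_integral_cong) (simp add: ennreal_mult ac_simps)
    also have "\<dots> = ennreal (norm y powr (- (n * e))) * (\<integral>\<^sup>+ x. ennreal (norm x powr (n * e - n)) * indicator {x. norm x \<le> norm y} (x::'a) \<partial>lborel)"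
      by (rule nn_integral_cmult) measurable
    also have "\<dots> \<le> ennreal (norm y powr (- (n * e))) * ennreal (C * norm y powr (n * e))"
      using C(2)[of "norm y"] False by (intro mult_left_mono) auto
    also have "\<dots> = ennreal C"
      using C(1) False by (subst ennreal_mult[symmetric]) (auto simp: powr_minus)
    finally show ?thesis .
  qed simp
  then show ?thesis using C(1) by blast
qed

text \<open>The kernel X^(-1) R^(-1-e), integrated over the larger point y instead.\<close>

lemma nn_integral_outer_kernel:
  fixes e :: real
  defines "n \<equiv> real DIM('a::euclidean_space)"
  assumes e: "0 < e"
  shows "\<exists>C\<ge>0. \<forall>x::'a. (\<integral>\<^sup>+ y. ennreal (norm x powr (n * e) * norm y powr (- (n * e) - n)) * indicator {y. norm x \<le> norm y} (y::'a) \<partial>lborel) \<le> ennreal C"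
proof -
  have ne: "0 < n * e" using e by (simp add: n_def)
  obtain C where C: "0 \<le> C" "\<And>\<rho>. \<rho> > 0 \<Longrightarrow> (\<integral>\<^sup>+ x. ennreal (norm x powr (- (n * e) - n)) * indicator {x. \<rho> \<le> norm x} (x::'a) \<partial>lborel)
            \<le> ennreal (C * \<rho> powr (- (n * e)))"
    using nn_integral_outside_powr[OF ne, where 'a='a] unfolding n_def by blast
  have "(\<integral>\<^sup>+ y. ennreal (norm x powr (n * e) * norm y powr (- (n * e) - n)) * indicator {y. norm x \<le> norm y} (y::'a) \<partial>lborel) \<le> ennreal C"
    for x :: 'a
  proof (cases "x = 0")
    case False
    have "(\<integral>\<^sup>+ y. ennreal (norm x powr (n * e) * norm y powr (- (n * e) - n)) * indicator {y. norm x \<le> norm y} (y::'a) \<partial>lborel)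
       = (\<integral>\<^sup>+ y. ennreal (norm x powr (n * e)) * (ennreal (norm y powr (- (n * e) - n)) * indicator {y. norm x \<le> norm y} (y::'a)) \<partial>lborel)"
      by (intro nn_integral_cong) (simp add: ennreal_mult ac_simps)
    also have "\<dots> = ennreal (norm x powr (n * e)) * (\<integral>\<^sup>+ y. ennreal (norm y powr (- (n * e) - n)) * indicator {y. norm x \<le> norm y} (y::'a) \<partial>lborel)"
      by (rule nn_integral_cmult) measurable
    also have "\<dots> \<le> ennreal (norm x powr (n * e)) * ennreal (C * norm x powr (- (n * e)))"
      using C(2)[of "norm x"] False by (intro mult_left_mono) auto
    also have "\<dots> = ennreal C"
      using C(1) False by (subst ennreal_mult[symmetric]) (auto simp: powr_minus)
    finally show ?thesis .
  qed simp
  then show ?thesis using C(1) by blast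
qed

text \<open>Here the decay in R carries the estimate. By scaling, its exponent (b + c)/n exceeds 1 -
  (A + B) by 1 - D - a/n, and this excess is positive by the strict condition on a.\<close>

lemma trilinear_smallest_small:
  fixes a b c A B D :: real
  defines "n \<equiv> real DIM('a::euclidean_space)"
  assumes A: "0 \<le> A" and B: "0 \<le> B" and D: "0 \<le> D" "D < 1" and AB: "A + B \<le> 1" "1 \<le> A + B + D"
    and scal: "A + B + D + (a + b + c) / n = 2" and a: "a < n * (1 - D)"
  shows "\<exists>C\<ge>0. \<forall>E1 E2 E3 :: 'a \<Rightarrow> real. unit_density E1 \<and> unit_density E2 \<and> unit_density E3 \<longrightarrow>
    (\<integral>\<^sup>+ x. \<integral>\<^sup>+ y. ennreal (trilinear_form a b c D A B E1 E2 E3 x y) * indicator (smallest_first x) y \<partial>lborel \<partial>lborel) \<le> ennreal C"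
proof -
  have n: "0 < n" by (simp add: n_def)
  \<comment> \<open>Half of the excess, so that the decay has the form 2e + (1 - (A + B)) of
    \<open>pw_prod_le_decay\<close>.\<close>
  define e where "e = (1 - D - a / n) / 2"
  have e: "0 < e" using a n by (simp add: e_def field_simps)
  have \<gamma>: "(b + c) / n = 2 * e + (1 - (A + B))"
  proof -
    have "2 * e = 1 - D - a / n" by (simp add: e_def)
    then show ?thesis using scal by (simp add: add_divide_distrib)
  qed
  obtain C1 where C1: "0 \<le> C1" "\<And>y::'a. (\<integral>\<^sup>+ x. ennreal (norm x powr (n * e - n) * norm y powr (- (n * e))) * indicator {x. norm x \<le> norm y} (x::'a) \<partial>lborel) \<le> ennreal C1"
    using nn_integral_inner_kernel[OF e, where 'a='a] unfolding n_def by blast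
  obtain C2 where C2: "0 \<le> C2" "\<And>x::'a. (\<integral>\<^sup>+ y. ennreal (norm x powr (n * e) * norm y powr (- (n * e) - n)) * indicator {y. norm x \<le> norm y} (y::'a) \<partial>lborel) \<le> ennreal C2"
    using nn_integral_outer_kernel[OF e, where 'a='a] unfolding n_def by blast
  \<comment> \<open>The first factor comes from the rescaling, the second from replacing y by x + y
    in the kernel that accompanies E3.\<close>
  define M where "M = 2 powr \<bar>c\<bar> * 2 powr (n * e)"
  have M0: "0 \<le> M" by (simp add: M_def)
  have "(\<integral>\<^sup>+ x. \<integral>\<^sup>+ y. ennreal (trilinear_form a b c D A B E1 E2 E3 x y) * indicator (smallest_first x) y \<partial>lborel \<partial>lborel)
      \<le> ennreal (M * (1 + 1 + C2 + C1 + C1))"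
    if E: "unit_density E1" "unit_density E2" "unit_density E3" for E1 E2 E3 :: "'a \<Rightarrow> real"
  proof -
    note [measurable] = E[THEN unit_densityD(1)]
    note nn = E[THEN unit_densityD(2)]
    define k where "k x y = ennreal (norm x powr (n * e - n) * norm y powr (- (n * e))) * indicator {x. norm x \<le> norm y} x" for x y :: 'a
    define h where "h x y = ennreal (norm x powr (n * e) * norm y powr (- (n * e) - n)) * indicator {y. norm x \<le> norm y} y" for x y :: 'a
    have [measurable]: "case_prod k \<in> borel_measurable (borel \<Otimes>\<^sub>M borel)" "case_prod h \<in> borel_measurable (borel \<Otimes>\<^sub>M borel)"
      unfolding k_def h_def indicator_def by measurable
    show ?thesis
    proof (rule nn_integral2_five_terms[where
          ?T1.0 = "\<lambda>x y. ennreal (E1 x * E2 y)" and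
          ?T2.0 = "\<lambda>x y. ennreal (E1 x * E3 (x + y))" and
          ?T3.0 = "\<lambda>x y. ennreal (E1 x) * h x y" and
          ?T4.0 = "\<lambda>x y. ennreal (E2 y) * k x y" and
          ?T5.0 = "\<lambda>x y. ennreal (E3 (x + y)) * k x (x + y)"])
      fix x y :: 'a
      assume x: "x \<noteq> 0"
      show "ennreal (trilinear_form a b c D A B E1 E2 E3 x y) * indicator (smallest_first x) y
        \<le> ennreal M * (ennreal (E1 x * E2 y) + ennreal (E1 x * E3 (x + y)) + ennreal (E1 x) * h x y +
          ennreal (E2 y) * k x y + ennreal (E3 (x + y)) * k x (x + y))"
      proof (cases "y \<in> smallest_first x")
        case True
        then have y: "norm x \<le> norm y" "norm x \<le> norm (x + y)" by (auto simp: smallest_first_def)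
        have nx: "0 < norm x" and ny: "0 < norm y" and nz: "0 < norm (x + y)" using x y by (auto intro: less_le_trans)
        define X where "X = norm x powr n"
        have X: "0 < X" using x by (simp add: X_def)
        have X2: "norm x powr (- (2 * n)) = inverse X * inverse X"
          by (auto simp: X_def powr_minus[symmetric] powr_add[symmetric])
        define R where "R = (norm y / norm x) powr n"
        have R: "1 \<le> R" unfolding R_def using y nx n by (intro ge_one_powr_ge_zero) auto
        define r where "r = norm x powr (n * e) * norm y powr (- (n * e))"
        have Re: "R powr (-e) = r"
        proof -
          have "R powr (-e) = (norm y / norm x) powr (- (n * e))" by (simp add: R_def powr_powr)
          also have "\<dots> = norm y powr (- (n * e)) / norm x powr (- (n * e))" by (rule powr_divide)
          finally show ?thesis by (simp add: r_def powr_minus divide_inverse mult.commute)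
        qed
        have R1e: "R powr (-1 - e) = r * X * norm y powr (- n)"
        proof -
          have "R powr (-1 - e) = R powr (-1) * R powr (-e)" by (simp only: powr_add[symmetric] diff_conv_add_uminus)
          also have "R powr (-1) = X * norm y powr (-n)"
            using R nx ny by (simp add: R_def X_def powr_divide powr_minus field_simps)
          finally show ?thesis by (simp add: Re)
        qed
        have k1: "k x y = ennreal (inverse X * r)" using y nx
          by (simp add: k_def r_def X_def powr_diff divide_inverse ac_simps)
        have h1: "h x y = ennreal (r * norm y powr (-n))" using y ny
          by (simp add: h_def r_def powr_diff divide_inverse powr_minus ac_simps)
        define r' where "r' = norm x powr (n * e) * norm (x + y) powr (- (n * e))"
        have k2: "k x (x + y) = ennreal (inverse X * r')" using y nx
          by (simp add: k_def r'_def X_def powr_diff divide_inverse ac_simps)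
        \<comment> \<open>The density E3 is evaluated at x + y, so its kernel has to be as well
          before the shifted Tonelli lemma applies; y and x + y have comparable norms.\<close>
        have rr: "r \<le> 2 powr (n * e) * r'"
        proof -
          have "norm y powr (- (n * e)) \<le> 2 powr \<bar>- (n * e)\<bar> * norm (x + y) powr (- (n * e))"
          proof (rule powr_comparable)
            show "norm y \<le> 2 * norm (x + y)" using norm_triangle_ineq4[of "x + y" x] y by simp
            show "norm (x + y) \<le> 2 * norm y" using norm_triangle_ineq[of x y] y by linarith
          qed (rule nz)
          then have "norm x powr (n * e) * norm y powr (- (n * e)) \<le> norm x powr (n * e) * (2 powr (n * e) * norm (x + y) powr (- (n * e)))"
            using n e by (intro mult_left_mono) auto
          then show ?thesis by (simp add: r_def r'_def ac_simps)
        qed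
        have r0: "0 \<le> r" "0 \<le> r'" by (auto simp: r_def r'_def)
        define P where "P = pw (X * E1 x) D * pw (X * E2 y) A * pw (X * E3 (x + y)) B"
        have "trilinear_form a b c D A B E1 E2 E3 x y \<le> 2 powr \<bar>c\<bar> * (norm x powr (- (2 * n)) * (P * R powr (- ((b + c) / n))))"
          unfolding P_def X_def R_def n_def
          using trilinear_form_rescale[where ?E1.0 = E1 and ?E2.0 = E2 and ?E3.0 = E3, OF x y nn(1) nn(2) nn(3) scal[unfolded n_def]] .
        also have "P * R powr (- ((b + c) / n)) \<le> X * E2 y * (X * E1 x) + X * E3 (x + y) * (X * E1 x)
              + X * E1 x * R powr (-1 - e) + X * E2 y * R powr (-e) + X * E3 (x + y) * R powr (-e)"
          unfolding P_def \<gamma> using X nn A B AB D R e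
          by (intro pw_prod_le_decay) auto
        also have "norm x powr (- (2 * n)) * \<dots> = E1 x * E2 y + E1 x * E3 (x + y) + E1 x * (r * norm y powr (-n)) + E2 y * (inverse X * r)
              + E3 (x + y) * (inverse X * r)"
          unfolding X2 Re R1e using X by (simp add: field_simps)
        also have "\<dots> \<le> 2 powr (n * e) * (E1 x * E2 y + E1 x * E3 (x + y) + E1 x * (r * norm y powr (-n)) + E2 y * (inverse X * r)
              + E3 (x + y) * (inverse X * r'))"
        proof -
          have one: "1 \<le> 2 powr (n * e)" using n e by (intro ge_one_powr_ge_zero) auto
          have "E3 (x + y) * (inverse X * r) \<le> E3 (x + y) * (inverse X * (2 powr (n * e) * r'))"
            using rr X nn by (intro mult_left_mono) auto
          then have last: "E3 (x + y) * (inverse X * r) \<le> 2 powr (n * e) * (E3 (x + y) * (inverse X * r'))"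
            by (simp only: ac_simps)
          have "t \<le> 2 powr (n * e) * t" if "0 \<le> t" for t
            using mult_right_mono[OF one that] by simp
          then show ?thesis
            unfolding distrib_left using nn r0 X by (intro add_mono last) auto
        qed
        finally have "trilinear_form a b c D A B E1 E2 E3 x y \<le> M * (E1 x * E2 y + E1 x * E3 (x + y) + E1 x * (r * norm y powr (-n)) + E2 y * (inverse X * r)
              + E3 (x + y) * (inverse X * r'))"
          by (simp add: mult_left_mono M_def mult.assoc)
        then have "ennreal (trilinear_form a b c D A B E1 E2 E3 x y) \<le> ennreal (M * (E1 x * E2 y + E1 x * E3 (x + y) + E1 x * (r * norm y powr (-n)) + E2 y * (inverse X * r)
              + E3 (x + y) * (inverse X * r')))"
          by (rule ennreal_leI)
        also have "\<dots> = ennreal M * (ennreal (E1 x * E2 y) + ennreal (E1 x * E3 (x + y)) + ennreal (E1 x) * h x y +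
          ennreal (E2 y) * k x y + ennreal (E3 (x + y)) * k x (x + y))"
          unfolding k1 k2 h1 using nn r0 X M0 by (simp add: ennreal_mult)
        finally show ?thesis using True by simp
      qed simp
    next
      \<comment> \<open>In this term the density sits at the outer variable x, so the inner integral
        is already that of the kernel.\<close>
      have "(\<integral>\<^sup>+ x. \<integral>\<^sup>+ y. ennreal (E1 x) * h x y \<partial>lborel \<partial>lborel) = (\<integral>\<^sup>+ x. ennreal (E1 x) * (\<integral>\<^sup>+ y. h x y \<partial>lborel) \<partial>lborel)"
        by (rule nn_integral_cong, rule nn_integral_cmult) measurable
      also have "\<dots> \<le> (\<integral>\<^sup>+ x. ennreal (E1 x) * ennreal C2 \<partial>lborel)"
        using C2(2) by (intro nn_integral_mono mult_left_mono) (auto simp: h_def)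
      also have "\<dots> = (\<integral>\<^sup>+ x. ennreal (E1 x) \<partial>lborel) * ennreal C2"
        by (rule nn_integral_multc) measurable
      also have "\<dots> \<le> 1 * ennreal C2" by (intro mult_right_mono unit_densityD(3)[OF E(1)]) simp
      finally show "(\<integral>\<^sup>+ x. \<integral>\<^sup>+ y. ennreal (E1 x) * h x y \<partial>lborel \<partial>lborel) \<le> ennreal C2" by simp
      show "(\<integral>\<^sup>+ x. \<integral>\<^sup>+ y. ennreal (E2 y) * k x y \<partial>lborel \<partial>lborel) \<le> ennreal C1"
        using C1(2) by (intro nn_integral_density_kernel E) (auto simp: k_def)
      show "(\<integral>\<^sup>+ x. \<integral>\<^sup>+ y. ennreal (E3 (x + y)) * k x (x + y) \<partial>lborel \<partial>lborel) \<le> ennreal C1"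
        using C1(2) by (intro nn_integral_density_kernel_shift E) (auto simp: k_def)
    qed (use C1(1) C2(1) M0 E in \<open>auto intro!: nn_integral_pair_product[unfolded ennreal_1]\<close>)
  qed
  then show ?thesis using C1(1) C2(1) M0 by (intro exI[of _ "M * (1 + 1 + C2 + C1 + C1)"]) auto
qed

text \<open>The two regimes meet at A + B = 1. Above it the estimate rests on the sums of weights,
  otherwise on the strict condition on a together with A + B + D >= 1.\<close>

lemma trilinear_smallest:
  fixes a b c A B D :: real
  defines "n \<equiv> real DIM('a::euclidean_space)"
  assumes A: "0 \<le> A" "A < 1" and B: "0 \<le> B" "B < 1" and D: "0 \<le> D" "D < 1" and ABD: "1 \<le> A + B + D"
    and scal: "A + B + D + (a + b + c) / n = 2" and sum: "0 \<le> a + b + c" and bc: "0 \<le> b + c" and a: "a < n * (1 - D)"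
  shows "\<exists>C\<ge>0. \<forall>E1 E2 E3 :: 'a \<Rightarrow> real. unit_density E1 \<and> unit_density E2 \<and> unit_density E3 \<longrightarrow>
    (\<integral>\<^sup>+ x. \<integral>\<^sup>+ y. ennreal (trilinear_form a b c D A B E1 E2 E3 x y) * indicator (smallest_first x) y \<partial>lborel \<partial>lborel) \<le> ennreal C"
proof (cases "1 < A + B")
  case True
  then show ?thesis
    using trilinear_smallest_large[where 'a='a, OF A(2) B(2) D True scal[unfolded n_def] sum bc] by blast
next
  case False
  then show ?thesis
    using trilinear_smallest_small[where 'a='a, OF A(1) B(1) D _ ABD scal[unfolded n_def] a[unfolded n_def]] by auto
qed

section \<open>Combining the three regions\<close>

lemma borel_measurable_trilinear_form:
  fixes E1 E2 E3 :: "'a::euclidean_space \<Rightarrow> real"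
  assumes [measurable]: "E1 \<in> borel_measurable borel" "E2 \<in> borel_measurable borel" "E3 \<in> borel_measurable borel"
  shows "(\<lambda>(x, y). trilinear_form a b c D A B E1 E2 E3 x y) \<in> borel_measurable (borel \<Otimes>\<^sub>M borel)"
  unfolding trilinear_form_def by measurable

lemma borel_measurable_smallest_first:
  "(\<lambda>(x, y). indicator (smallest_first (x::'a::euclidean_space)) y :: ennreal) \<in> borel_measurable (borel \<Otimes>\<^sub>M borel)"
  unfolding smallest_first_def indicator_def by measurable

lemma nn_integral_shear:
  fixes G :: "'a::euclidean_space \<Rightarrow> 'a \<Rightarrow> ennreal"
  assumes [measurable]: "case_prod G \<in> borel_measurable (borel \<Otimes>\<^sub>M borel)"
  shows "(\<integral>\<^sup>+ x. \<integral>\<^sup>+ y. G y (x - y) \<partial>lborel \<partial>lborel) = (\<integral>\<^sup>+ x. \<integral>\<^sup>+ y. G x y \<partial>lborel \<partial>lborel)"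
proof -
  have "(\<integral>\<^sup>+ x. \<integral>\<^sup>+ y. G y (x - y) \<partial>lborel \<partial>lborel) = (\<integral>\<^sup>+ y. \<integral>\<^sup>+ x. G y (x - y) \<partial>lborel \<partial>lborel)"
    by (rule lborel_pair.Fubini'[symmetric]) measurable
  also have "\<dots> = (\<integral>\<^sup>+ y. \<integral>\<^sup>+ x. G y x \<partial>lborel \<partial>lborel)"
  proof (rule nn_integral_cong)
    fix y :: 'a
    show "(\<integral>\<^sup>+ x. G y (x - y) \<partial>lborel) = (\<integral>\<^sup>+ x. G y x \<partial>lborel)"
      using nn_integral_lborel_plus[of "G y" "- y"] by simp
  qed
  finally show ?thesis .
qed

text \<open>P, \<Theta>, Q stand for 1/p, 1/\<theta> and 1 - 1/q. Each of the three points is put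
  into the first slot of \<open>trilinear_smallest\<close> once: its own strict condition is the
  bound on a, the pair sum of the other two is b + c >= 0, and half the total of all pair sums is a
  + b + c >= 0.\<close>

lemma trilinear_conv_bound:
  fixes \<alpha> \<beta> s P Q \<Theta> :: real
  defines "n \<equiv> real DIM('a::euclidean_space)"
  assumes P: "0 \<le> P" "P < 1" and Th: "0 \<le> \<Theta>" "\<Theta> < 1" and Q: "0 \<le> Q" "Q < 1" and ge: "1 \<le> P + \<Theta> + Q"
    and scal: "P + \<Theta> + Q + (\<alpha> + \<beta> + s) / n = 2"
    and \<alpha>: "\<alpha> < n * (1 - P)" and \<beta>: "\<beta> < n * (1 - Q)" and s: "s < n * (1 - \<Theta>)"
    and pairs: "0 \<le> \<alpha> + \<beta>" "0 \<le> \<alpha> + s" "0 \<le> \<beta> + s"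
  shows "\<exists>C\<ge>0. \<forall>E1 E2 E3 :: 'a \<Rightarrow> real. unit_density E1 \<and> unit_density E2 \<and> unit_density E3 \<longrightarrow>
    (\<integral>\<^sup>+ x. \<integral>\<^sup>+ y. ennreal (trilinear_form \<alpha> s \<beta> P \<Theta> Q E1 E2 E3 y (x - y)) \<partial>lborel \<partial>lborel) \<le> ennreal C"
proof -
  have "\<exists>C\<ge>0. \<forall>E1 E2 E3 :: 'a \<Rightarrow> real. unit_density E1 \<and> unit_density E2 \<and> unit_density E3 \<longrightarrow>
    (\<integral>\<^sup>+ x. \<integral>\<^sup>+ y. ennreal (trilinear_form \<alpha> s \<beta> P \<Theta> Q E1 E2 E3 x y) * indicator (smallest_first x) y \<partial>lborel \<partial>lborel) \<le> ennreal C"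
    using assms unfolding n_def by (intro trilinear_smallest) (auto simp: ac_simps)
  then obtain C1 where C1: "0 \<le> C1" "\<And>E1 E2 E3 :: 'a \<Rightarrow> real. unit_density E1 \<Longrightarrow> unit_density E2 \<Longrightarrow> unit_density E3 \<Longrightarrow>
    (\<integral>\<^sup>+ x. \<integral>\<^sup>+ y. ennreal (trilinear_form \<alpha> s \<beta> P \<Theta> Q E1 E2 E3 x y) * indicator (smallest_first x) y \<partial>lborel \<partial>lborel) \<le> ennreal C1"
    by blast
  have "\<exists>C\<ge>0. \<forall>E1 E2 E3 :: 'a \<Rightarrow> real. unit_density E1 \<and> unit_density E2 \<and> unit_density E3 \<longrightarrow>
    (\<integral>\<^sup>+ x. \<integral>\<^sup>+ y. ennreal (trilinear_form s \<alpha> \<beta> \<Theta> P Q E1 E2 E3 x y) * indicator (smallest_first x) y \<partial>lborel \<partial>lborel) \<le> ennreal C"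
    using assms unfolding n_def by (intro trilinear_smallest) (auto simp: ac_simps)
  then obtain C2 where C2: "0 \<le> C2" "\<And>E1 E2 E3 :: 'a \<Rightarrow> real. unit_density E1 \<Longrightarrow> unit_density E2 \<Longrightarrow> unit_density E3 \<Longrightarrow>
    (\<integral>\<^sup>+ x. \<integral>\<^sup>+ y. ennreal (trilinear_form s \<alpha> \<beta> \<Theta> P Q E1 E2 E3 x y) * indicator (smallest_first x) y \<partial>lborel \<partial>lborel) \<le> ennreal C2"
    by blast
  have "\<exists>C\<ge>0. \<forall>E1 E2 E3 :: 'a \<Rightarrow> real. unit_density E1 \<and> unit_density E2 \<and> unit_density E3 \<longrightarrow>
    (\<integral>\<^sup>+ x. \<integral>\<^sup>+ y. ennreal (trilinear_form \<beta> \<alpha> s Q P \<Theta> E1 E2 E3 x y) * indicator (smallest_first x) y \<partial>lborel \<partial>lborel) \<le> ennreal C"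
    using assms unfolding n_def by (intro trilinear_smallest) (auto simp: ac_simps)
  then obtain C3 where C3: "0 \<le> C3" "\<And>E1 E2 E3 :: 'a \<Rightarrow> real. unit_density E1 \<Longrightarrow> unit_density E2 \<Longrightarrow> unit_density E3 \<Longrightarrow>
    (\<integral>\<^sup>+ x. \<integral>\<^sup>+ y. ennreal (trilinear_form \<beta> \<alpha> s Q P \<Theta> E1 E2 E3 x y) * indicator (smallest_first x) y \<partial>lborel \<partial>lborel) \<le> ennreal C3"
    by blast
  have "(\<integral>\<^sup>+ x. \<integral>\<^sup>+ y. ennreal (trilinear_form \<alpha> s \<beta> P \<Theta> Q E1 E2 E3 y (x - y)) \<partial>lborel \<partial>lborel) \<le> ennreal (C1 + C2 + C3)"
    if E: "unit_density E1" "unit_density E2" "unit_density E3" for E1 E2 E3 :: "'a \<Rightarrow> real"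
  proof -
    note [measurable] = E[THEN unit_densityD(1)]
    \<comment> \<open>With x in the first slot the relation reads x + (- y) = x - y, so the density
      of y is evaluated at the reflected point.\<close>
    define F1 where "F1 x = E1 (- x)" for x
    have [measurable]: "F1 \<in> borel_measurable borel" unfolding F1_def by measurable
    have F1: "unit_density F1"
      using nn_integral_lborel_minus[of "\<lambda>x. ennreal (E1 x)" 0] unit_densityD[OF E(1)]
      by (auto simp: unit_density_def F1_def)
    define G1 where "G1 x y = ennreal (trilinear_form \<alpha> s \<beta> P \<Theta> Q E1 E2 E3 x y) * indicator (smallest_first x) y" for x y
    define G2 where "G2 x y = ennreal (trilinear_form s \<alpha> \<beta> \<Theta> P Q E2 E1 E3 x y) * indicator (smallest_first x) y" for x y
    define G3 where "G3 x y = ennreal (trilinear_form \<beta> \<alpha> s Q P \<Theta> E3 F1 E2 x y) * indicator (smallest_first x) y" for x y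
    note [measurable] = borel_measurable_trilinear_form borel_measurable_smallest_first
    have [measurable]: "case_prod G1 \<in> borel_measurable (borel \<Otimes>\<^sub>M borel)" unfolding G1_def by measurable
    have [measurable]: "case_prod G2 \<in> borel_measurable (borel \<Otimes>\<^sub>M borel)" unfolding G2_def by measurable
    have [measurable]: "case_prod G3 \<in> borel_measurable (borel \<Otimes>\<^sub>M borel)" unfolding G3_def by measurable
    have pt: "ennreal (trilinear_form \<alpha> s \<beta> P \<Theta> Q E1 E2 E3 y (x - y)) \<le> G1 y (x - y) + G2 (x - y) y + G3 x (- y)" for x y
    proof -
      have 2: "trilinear_form s \<alpha> \<beta> \<Theta> P Q E2 E1 E3 (x - y) y = trilinear_form \<alpha> s \<beta> P \<Theta> Q E1 E2 E3 y (x - y)"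
        by (simp add: trilinear_form_def ac_simps)
      have 3: "trilinear_form \<beta> \<alpha> s Q P \<Theta> E3 F1 E2 x (- y) = trilinear_form \<alpha> s \<beta> P \<Theta> Q E1 E2 E3 y (x - y)"
        by (simp add: trilinear_form_def F1_def ac_simps)
      \<comment> \<open>Some point has the smallest norm; ties are counted repeatedly, which is
        harmless for an upper bound.\<close>
      consider "norm y \<le> norm (x - y)" "norm y \<le> norm x" | "norm (x - y) \<le> norm y" "norm (x - y) \<le> norm x"
        | "norm x \<le> norm y" "norm x \<le> norm (x - y)" by linarith
      then show ?thesis
        by cases (auto simp: G1_def G2_def G3_def 2 3 smallest_first_def add_increasing add_increasing2)
    qed
    have "(\<integral>\<^sup>+ x. \<integral>\<^sup>+ y. ennreal (trilinear_form \<alpha> s \<beta> P \<Theta> Q E1 E2 E3 y (x - y)) \<partial>lborel \<partial>lborel)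
       \<le> (\<integral>\<^sup>+ x. \<integral>\<^sup>+ y. G1 y (x - y) + G2 (x - y) y + G3 x (- y) \<partial>lborel \<partial>lborel)"
      by (intro nn_integral_mono pt)
    also have "\<dots> = (\<integral>\<^sup>+ x. \<integral>\<^sup>+ y. G1 y (x - y) \<partial>lborel \<partial>lborel) + (\<integral>\<^sup>+ x. \<integral>\<^sup>+ y. G2 (x - y) y \<partial>lborel \<partial>lborel)
        + (\<integral>\<^sup>+ x. \<integral>\<^sup>+ y. G3 x (- y) \<partial>lborel \<partial>lborel)"
      by (simp add: nn_integral_add)
    also have "(\<integral>\<^sup>+ x. \<integral>\<^sup>+ y. G1 y (x - y) \<partial>lborel \<partial>lborel) = (\<integral>\<^sup>+ x. \<integral>\<^sup>+ y. G1 x y \<partial>lborel \<partial>lborel)"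
      by (rule nn_integral_shear) measurable
    also have "(\<integral>\<^sup>+ x. \<integral>\<^sup>+ y. G2 (x - y) y \<partial>lborel \<partial>lborel) = (\<integral>\<^sup>+ x. \<integral>\<^sup>+ y. G2 y x \<partial>lborel \<partial>lborel)"
      by (rule nn_integral_shear[where G = "\<lambda>x y. G2 y x"]) measurable
    also have "\<dots> = (\<integral>\<^sup>+ x. \<integral>\<^sup>+ y. G2 x y \<partial>lborel \<partial>lborel)"
      by (rule lborel_pair.Fubini') measurable
    also have "(\<integral>\<^sup>+ x. \<integral>\<^sup>+ y. G3 x (- y) \<partial>lborel \<partial>lborel) = (\<integral>\<^sup>+ x. \<integral>\<^sup>+ y. G3 x y \<partial>lborel \<partial>lborel)"
    proof (rule nn_integral_cong)
      fix x :: 'a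
      show "(\<integral>\<^sup>+ y. G3 x (- y) \<partial>lborel) = (\<integral>\<^sup>+ y. G3 x y \<partial>lborel)"
        using nn_integral_lborel_minus[of "G3 x" 0] by simp
    qed
    also have "(\<integral>\<^sup>+ x. \<integral>\<^sup>+ y. G1 x y \<partial>lborel \<partial>lborel) + (\<integral>\<^sup>+ x. \<integral>\<^sup>+ y. G2 x y \<partial>lborel \<partial>lborel) + (\<integral>\<^sup>+ x. \<integral>\<^sup>+ y. G3 x y \<partial>lborel \<partial>lborel)
       \<le> ennreal C1 + ennreal C2 + ennreal C3"
      unfolding G1_def G2_def G3_def by (intro add_mono C1 C2 C3 E F1)
    also have "\<dots> = ennreal (C1 + C2 + C3)" using C1(1) C2(1) C3(1) by simp
    finally show ?thesis .
  qed
  then show ?thesis using C1(1) C2(1) C3(1) by (intro exI[of _ "C1 + C2 + C3"]) auto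
qed

section \<open>Duality and sufficiency\<close>

text \<open>Converse of Hoelder's inequality: the extremal density is t^q divided by its integral S,
  and testing with it gives S^(1/q) <= C. Finiteness of S makes the normalisation possible.\<close>

lemma powr_norm_bound_by_duality_truncated:
  fixes t :: "'a::euclidean_space \<Rightarrow> real" and T :: "'a \<Rightarrow> ennreal" and q C :: real
  assumes q: "1 < q" and C: "0 \<le> C"
    and tm [measurable]: "t \<in> borel_measurable borel" and t0: "\<And>x. 0 \<le> t x"
    and tT: "\<And>x. ennreal (t x) \<le> T x"
    and fin: "(\<integral>\<^sup>+ x. ennreal (t x powr q) \<partial>lborel) < \<infinity>"
    and dual: "\<And>E. unit_density E \<Longrightarrow> (\<integral>\<^sup>+ x. T x * ennreal (pw (E x) (1 - 1 / q)) \<partial>lborel) \<le> ennreal C"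
  shows "(\<integral>\<^sup>+ x. ennreal (t x powr q) \<partial>lborel) \<le> ennreal (C powr q)"
proof -
  obtain S where S: "0 \<le> S" "(\<integral>\<^sup>+ x. ennreal (t x powr q) \<partial>lborel) = ennreal S"
    using fin by (cases "\<integral>\<^sup>+ x. ennreal (t x powr q) \<partial>lborel") auto
  show ?thesis
  proof (cases "S = 0")
    case False
    then have S0: "0 < S" using S by simp
    define E where "E x = t x powr q / S" for x
    have Em [measurable]: "E \<in> borel_measurable borel" unfolding E_def by measurable
    have "(\<integral>\<^sup>+ x. ennreal (E x) \<partial>lborel) = (\<integral>\<^sup>+ x. ennreal (t x powr q) * ennreal (1 / S) \<partial>lborel)"
      using S0 by (intro nn_integral_cong) (simp add: E_def ennreal_mult[symmetric])
    also have "\<dots> = ennreal S * ennreal (1 / S)"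
      by (subst nn_integral_multc) (auto simp: S(2))
    also have "\<dots> = 1" using S0 by (subst ennreal_mult[symmetric]) auto
    finally have E: "unit_density E" using S0 by (auto simp: unit_density_def E_def)
    have q': "1 - 1 / q \<noteq> 0" using q by auto
    have pt: "ennreal (t x powr q) * ennreal (S powr (- (1 - 1 / q))) \<le> T x * ennreal (pw (E x) (1 - 1 / q))" for x
    proof -
      have "pw (E x) (1 - 1 / q) = t x powr (q - 1) * S powr (- (1 - 1 / q))"
      proof -
        have "q * (1 - 1 / q) = q - 1" using q by (simp add: field_simps)
        then have "(t x powr q) powr (1 - 1 / q) = t x powr (q - 1)" by (simp only: powr_powr)
        then show ?thesis using q' by (simp only: pw_def E_def powr_divide if_False powr_minus) (simp only: divide_inverse)
      qed
      then have "t x powr q * S powr (- (1 - 1 / q)) = t x * pw (E x) (1 - 1 / q)"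
        using powr_mult_base[of "t x" "q - 1"] t0[of x] by simp
      then have "ennreal (t x powr q) * ennreal (S powr (- (1 - 1 / q))) = ennreal (t x) * ennreal (pw (E x) (1 - 1 / q))"
        using t0[of x] by (simp add: ennreal_mult[symmetric] pw_nonneg)
      then show ?thesis using tT[of x] by (simp add: mult_right_mono)
    qed
    have "ennreal S * ennreal (S powr (- (1 - 1 / q))) = (\<integral>\<^sup>+ x. ennreal (t x powr q) * ennreal (S powr (- (1 - 1 / q))) \<partial>lborel)"
      by (subst nn_integral_multc) (auto simp: S(2))
    also have "\<dots> \<le> (\<integral>\<^sup>+ x. T x * ennreal (pw (E x) (1 - 1 / q)) \<partial>lborel)"
      by (intro nn_integral_mono pt)
    also have "\<dots> \<le> ennreal C" by (rule dual[OF E])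
    finally have "ennreal (S * S powr (- (1 - 1 / q))) \<le> ennreal C" using S0 by (simp add: ennreal_mult)
    then have "S * S powr (- (1 - 1 / q)) \<le> C" using C by simp
    moreover have "S * S powr (- (1 - 1 / q)) = S powr (1 / q)"
      using powr_mult_base[of S "- (1 - 1 / q)"] S0 by simp
    ultimately have "S powr (1 / q) \<le> C" by simp
    then have "(S powr (1 / q)) powr q \<le> C powr q" using q by (intro powr_mono2) auto
    moreover have "(S powr (1 / q)) powr q = S" using S0 q by (simp add: powr_powr)
    ultimately show ?thesis using S(2) by (simp add: ennreal_leI)
  qed (simp add: S)
qed

text \<open>T is truncated at height N and to the ball of radius N, which makes the integral finite,
  and N tends to infinity by monotone convergence. Finiteness almost everywhere is a conclusion of
  its own because \<open>enn2real\<close> sends infinity to 0.\<close>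

lemma powr_norm_bound_by_duality:
  fixes T :: "'a::euclidean_space \<Rightarrow> ennreal" and q C :: real
  assumes q: "1 < q" and C: "0 \<le> C" and [measurable]: "T \<in> borel_measurable borel"
    and dual: "\<And>E. unit_density E \<Longrightarrow> (\<integral>\<^sup>+ x. T x * ennreal (pw (E x) (1 - 1 / q)) \<partial>lborel) \<le> ennreal C"
  shows "AE x in lborel. T x < \<infinity>"
    and "(\<integral>\<^sup>+ x. ennreal (enn2real (T x) powr q) \<partial>lborel) \<le> ennreal (C powr q)"
proof -
  define t where "t N x = enn2real (min (T x) (ennreal (real N))) * indicator (cball 0 (real N)) x" for N :: nat and x
  have [measurable]: "t N \<in> borel_measurable borel" for N unfolding t_def by measurable
  have t0: "0 \<le> t N x" for N x by (simp add: t_def)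
  have tle: "ennreal (t N x) \<le> min (T x) (ennreal (real N))" for N x
    by (cases "min (T x) (ennreal (real N))") (auto simp: t_def indicator_def min_def split: if_splits)
  have tN: "t N x \<le> real N * indicator (cball 0 (real N)) x" for N x
  proof -
    have "enn2real (min (T x) (ennreal (real N))) \<le> real N"
      by (rule enn2real_leI) auto
    then show ?thesis by (simp add: t_def indicator_def)
  qed
  have mono: "t N x \<le> t M x" if "N \<le> M" for N M x
  proof -
    have "enn2real (min (T x) (ennreal (real N))) \<le> enn2real (min (T x) (ennreal (real M)))"
      using that by (intro enn2real_mono min.mono ennreal_leI) (auto simp: min_less_iff_disj)
    then show ?thesis using that by (auto simp: t_def indicator_def)
  qed
  have bound: "(\<integral>\<^sup>+ x. ennreal (t N x powr q) \<partial>lborel) \<le> ennreal (C powr q)" for N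
  proof (rule powr_norm_bound_by_duality_truncated[OF q C _ t0 _ _ dual])
    show "ennreal (t N x) \<le> T x" for x using tle[of N x] by simp
    have "(\<integral>\<^sup>+ x. ennreal (t N x powr q) \<partial>lborel) \<le> (\<integral>\<^sup>+ x. ennreal (real N powr q) * indicator (cball 0 (real N)) x \<partial>(lborel :: 'a measure))"
    proof (rule nn_integral_mono)
      fix x :: 'a
      show "ennreal (t N x powr q) \<le> ennreal (real N powr q) * indicator (cball 0 (real N)) x"
        using tN[of N x] t0[of N x] q by (cases "x \<in> cball 0 (real N)") (auto intro!: ennreal_leI powr_mono2)
    qed
    also have "\<dots> = ennreal (real N powr q) * emeasure lborel (cball (0::'a) (real N))"
      by (rule nn_integral_cmult_indicator) simp
    also have "\<dots> < \<infinity>" by (simp add: ennreal_mult_less_top emeasure_cball)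
    finally show "(\<integral>\<^sup>+ x. ennreal (t N x powr q) \<partial>lborel) < \<infinity>" .
  qed auto
  define L where "L x = (SUP N. ennreal (t N x powr q))" for x
  have [measurable]: "L \<in> borel_measurable borel" unfolding L_def by measurable
  have "(\<integral>\<^sup>+ x. L x \<partial>lborel) = (SUP N. \<integral>\<^sup>+ x. ennreal (t N x powr q) \<partial>lborel)"
    unfolding L_def
  proof (rule nn_integral_monotone_convergence_SUP)
    show "incseq (\<lambda>N x. ennreal (t N x powr q))"
      using mono t0 q by (auto simp: incseq_def le_fun_def intro!: ennreal_leI powr_mono2)
  qed auto
  also have "\<dots> \<le> ennreal (C powr q)" by (intro SUP_least bound)
  finally have LC: "(\<integral>\<^sup>+ x. L x \<partial>lborel) \<le> ennreal (C powr q)" .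
  have LN: "ennreal (t N x powr q) \<le> L x" for N x unfolding L_def by (intro SUP_upper) auto
  have "AE x in lborel. L x \<noteq> \<infinity>"
    using LC by (intro nn_integral_PInf_AE) (auto simp: top_unique)
  \<comment> \<open>Where T is infinite, the truncation equals N as soon as N is at least the norm
    of x, so its powers are unbounded.\<close>
  moreover have "L x = \<infinity>" if T: "T x = \<infinity>" for x
  proof (rule ccontr)
    assume "L x \<noteq> \<infinity>"
    then obtain l where l: "0 \<le> l" "L x = ennreal l" by (cases "L x") auto
    obtain N where N: "max (max 1 (norm x)) (l + 1) \<le> real N" using real_arch_simple by blast
    have "t N x = real N" using T N by (simp add: t_def)
    then have "real N powr q \<le> l" using LN[of N x] l by simp
    moreover have "real N powr 1 \<le> real N powr q" using N q by (intro powr_mono) auto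
    ultimately show False using N by simp
  qed
  ultimately show "AE x in lborel. T x < \<infinity>"
    by (metis (mono_tags, lifting) eventually_mono infinity_ennreal_def less_top)
  have "ennreal (enn2real (T x) powr q) \<le> L x" for x
  proof (cases "T x")
    case (real r)
    obtain N where N: "max (norm x) r \<le> real N" using real_arch_simple by blast
    have "t N x = r" using real N by (simp add: t_def min_def ennreal_leI)
    then show ?thesis using LN[of N x] real by simp
  qed simp
  then show "(\<integral>\<^sup>+ x. ennreal (enn2real (T x) powr q) \<partial>lborel) \<le> ennreal (C powr q)"
    using LC by (meson nn_integral_mono order_trans)
qed

section \<open>Weighted norms and normalised densities\<close>

lemma wnorm_le_iff:
  fixes f :: "'a::euclidean_space \<Rightarrow> real"
  assumes p: "0 < p" and M: "0 \<le> M"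
  shows "wnorm (ereal p) t f \<le> ennreal M \<longleftrightarrow>
    (\<integral>\<^sup>+ x. ennreal ((\<bar>f x\<bar> * norm x powr t) powr p) \<partial>lborel) \<le> ennreal (M powr p)"
proof -
  define I where "I = (\<integral>\<^sup>+ x. ennreal ((\<bar>f x\<bar> * norm x powr t) powr p) \<partial>lborel)"
  have W: "wnorm (ereal p) t f = (if I = \<infinity> then \<infinity> else ennreal (enn2real I powr (1 / p)))"
    by (simp add: wnorm_def I_def Let_def)
  show ?thesis
  proof (cases I)
    case (real i)
    have "i powr (1 / p) \<le> M \<longleftrightarrow> i \<le> M powr p"
    proof
      assume "i powr (1 / p) \<le> M"
      then have "(i powr (1 / p)) powr p \<le> M powr p" using p by (intro powr_mono2) auto
      then show "i \<le> M powr p" using p real by (simp add: powr_powr)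
    next
      assume "i \<le> M powr p"
      then have "i powr (1 / p) \<le> (M powr p) powr (1 / p)" using p real by (intro powr_mono2) auto
      then show "i powr (1 / p) \<le> M" using p M by (simp add: powr_powr)
    qed
    then show ?thesis using real M by (simp add: W flip: I_def)
  next
    case top
    then show ?thesis by (simp add: W top_unique flip: I_def)
  qed
qed

text \<open>For finite \<theta> the density is (|f| |x|^t / M)^\<theta>. For \<theta> = \<infinity>
  the exponent \<open>inv_exp\<close> is 0, so \<open>pw\<close> is 1 and the zero density serves.
  The origin is an exceptional point, since \<open>norm x powr (- t)\<close> is 0 there.\<close>

lemma wnorm_density:
  fixes f :: "'a::euclidean_space \<Rightarrow> real"
  assumes th: "1 < \<theta>" and [measurable]: "f \<in> borel_measurable borel" and M: "0 < M" and le: "wnorm \<theta> t f \<le> ennreal M"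
  obtains E where "unit_density E" "AE x in lborel. \<bar>f x\<bar> \<le> M * (norm x powr (- t) * pw (E x) (inv_exp \<theta>))"
proof (cases \<theta>)
  case (real p)
  have p: "1 < p" using th real by simp
  define E where "E x = (\<bar>f x\<bar> * norm x powr t / M) powr p" for x
  have [measurable]: "E \<in> borel_measurable borel" unfolding E_def by measurable
  have "(\<integral>\<^sup>+ x. ennreal (E x) \<partial>lborel) = (\<integral>\<^sup>+ x. ennreal ((\<bar>f x\<bar> * norm x powr t) powr p) * ennreal (1 / M powr p) \<partial>lborel)"
    using M by (intro nn_integral_cong) (simp add: E_def powr_divide ennreal_mult[symmetric])
  also have "\<dots> = (\<integral>\<^sup>+ x. ennreal ((\<bar>f x\<bar> * norm x powr t) powr p) \<partial>lborel) * ennreal (1 / M powr p)"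
    by (rule nn_integral_multc) measurable
  also have "\<dots> \<le> ennreal (M powr p) * ennreal (1 / M powr p)"
    using le M p real by (intro mult_right_mono) (auto simp: wnorm_le_iff)
  also have "\<dots> = 1" using M by (subst ennreal_mult[symmetric]) auto
  finally have "unit_density E" by (auto simp: unit_density_def E_def)
  moreover have "AE x in lborel. \<bar>f x\<bar> \<le> M * (norm x powr (- t) * pw (E x) (inv_exp \<theta>))"
    using AE_lborel_singleton[of "0::'a"]
  proof eventually_elim
    case (elim x)
    have "pw (E x) (inv_exp \<theta>) = \<bar>f x\<bar> * norm x powr t / M"
      using p M real by (simp add: pw_def inv_exp_def E_def powr_powr)
    then show ?case using M elim by (simp add: powr_minus field_simps)
  qed
  ultimately show ?thesis by (rule that)
next
  case PInf
  have "unit_density (\<lambda>x::'a. 0)" by (simp add: unit_density_def)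
  moreover have "AE x in lborel. ennreal (\<bar>f x\<bar> * norm x powr t) \<le> ennreal M"
    using esssup_AE[of "\<lambda>x. ennreal (\<bar>f x\<bar> * norm x powr t)" lborel] le PInf
    by (auto elim!: eventually_mono simp: wnorm_def)
  with AE_lborel_singleton[of "0::'a"]
  have "AE x in lborel. \<bar>f x\<bar> \<le> M * (norm x powr (- t) * pw 0 (inv_exp \<theta>))"
  proof eventually_elim
    case (elim x)
    then have "\<bar>f x\<bar> * norm x powr t \<le> M" using M by simp
    then show ?case using PInf elim by (simp add: pw_def inv_exp_def powr_minus field_simps)
  qed
  ultimately show ?thesis by (rule that)
next
  case MInf
  then show ?thesis using th by simp
qed

text \<open>Duality in L^q. Once \<open>wnorm_density\<close> dominates f and K, the pairing of a
  density with the weighted convolution of |K| and |f| is at most M1 M2 times the trilinear form. M1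
  and M2 are positive because the densities are normalised by them.\<close>

lemma conv_bound_normalized:
  fixes f K :: "'a::euclidean_space \<Rightarrow> real" and p q \<alpha> \<beta> s C M1 M2 :: real
  assumes p: "1 < p" and q: "1 < q" and th: "1 < \<theta>" and C: "0 \<le> C"
    and tri: "\<And>E1 E2 E3 :: 'a \<Rightarrow> real. unit_density E1 \<Longrightarrow> unit_density E2 \<Longrightarrow> unit_density E3 \<Longrightarrow>
      (\<integral>\<^sup>+ x. \<integral>\<^sup>+ y. ennreal (trilinear_form \<alpha> s \<beta> (1 / p) (inv_exp \<theta>) (1 - 1 / q) E1 E2 E3 y (x - y)) \<partial>lborel \<partial>lborel) \<le> ennreal C"
    and [measurable]: "f \<in> borel_measurable borel" "K \<in> borel_measurable borel"
    and M: "0 < M1" "0 < M2" and f: "wnorm (ereal p) \<alpha> f \<le> ennreal M1" and K: "wnorm \<theta> s K \<le> ennreal M2"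
  shows "(AE x in lborel. integrable lborel (\<lambda>y. K (x - y) * f y))"
    and "wnorm (ereal q) (- \<beta>) (conv f K) \<le> ennreal (C * (M1 * M2))"
proof -
  have p': "1 < ereal p" using p by simp
  obtain E1 where E1: "unit_density E1" "AE x in lborel. \<bar>f x\<bar> \<le> M1 * (norm x powr (- \<alpha>) * pw (E1 x) (1 / p))"
    using wnorm_density[OF p' _ M(1) f] by (auto simp: inv_exp_def)
  obtain E2 where E2: "unit_density E2" "AE x in lborel. \<bar>K x\<bar> \<le> M2 * (norm x powr (- s) * pw (E2 x) (inv_exp \<theta>))"
    using wnorm_density[OF th _ M(2) K] by auto
  note [measurable] = unit_densityD(1)[OF E1(1)] unit_densityD(1)[OF E2(1)] borel_measurable_trilinear_form
  \<comment> \<open>Absolute values come first, so that everything up to the finiteness of T takes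
    place in \<open>ennreal\<close>; integrability follows from it.\<close>
  define J where "J x = (\<integral>\<^sup>+ y. ennreal (\<bar>K (x - y)\<bar> * \<bar>f y\<bar>) \<partial>lborel)" for x
  have [measurable]: "J \<in> borel_measurable borel" unfolding J_def by measurable
  define T where "T x = ennreal (norm x powr (- \<beta>)) * J x" for x
  have [measurable]: "T \<in> borel_measurable borel" unfolding T_def by measurable
  have dual: "(\<integral>\<^sup>+ x. T x * ennreal (pw (E x) (1 - 1 / q)) \<partial>lborel) \<le> ennreal (C * (M1 * M2))"
    if E: "unit_density E" for E
  proof -
    note [measurable] = unit_densityD(1)[OF E]
    define F where "F x y = trilinear_form \<alpha> s \<beta> (1 / p) (inv_exp \<theta>) (1 - 1 / q) E1 E2 E y (x - y)" for x y
    have [measurable]: "(\<lambda>(x, y). F x y) \<in> borel_measurable (borel \<Otimes>\<^sub>M borel)"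
      unfolding F_def trilinear_form_def by measurable
    have F0: "0 \<le> F x y" for x y by (simp add: F_def trilinear_form_def pw_nonneg)
    have "T x * ennreal (pw (E x) (1 - 1 / q)) \<le> (\<integral>\<^sup>+ y. ennreal (M1 * M2) * ennreal (F x y) \<partial>lborel)" for x
    proof -
      define w where "w = norm x powr (- \<beta>) * pw (E x) (1 - 1 / q)"
      have w: "0 \<le> w" by (simp add: w_def pw_nonneg)
      have "T x * ennreal (pw (E x) (1 - 1 / q)) = ennreal w * J x"
        by (simp add: T_def w_def ennreal_mult pw_nonneg ac_simps)
      also have "\<dots> = (\<integral>\<^sup>+ y. ennreal w * ennreal (\<bar>K (x - y)\<bar> * \<bar>f y\<bar>) \<partial>lborel)"
        unfolding J_def by (rule nn_integral_cmult[symmetric]) measurable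
      also have "\<dots> \<le> (\<integral>\<^sup>+ y. ennreal (M1 * M2) * ennreal (F x y) \<partial>lborel)"
      proof (rule nn_integral_mono_AE)
        show "AE y in lborel. ennreal w * ennreal (\<bar>K (x - y)\<bar> * \<bar>f y\<bar>) \<le> ennreal (M1 * M2) * ennreal (F x y)"
          using E1(2) AE_lborel_minus[OF E2(2), of x]
        proof eventually_elim
          case (elim y)
          have "\<bar>K (x - y)\<bar> * \<bar>f y\<bar> \<le> (M2 * (norm (x - y) powr (- s) * pw (E2 (x - y)) (inv_exp \<theta>))) * (M1 * (norm y powr (- \<alpha>) * pw (E1 y) (1 / p)))"
            using elim M by (intro mult_mono) (auto simp: pw_nonneg)
          then have "w * (\<bar>K (x - y)\<bar> * \<bar>f y\<bar>) \<le> w * ((M2 * (norm (x - y) powr (- s) * pw (E2 (x - y)) (inv_exp \<theta>))) * (M1 * (norm y powr (- \<alpha>) * pw (E1 y) (1 / p))))"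
            using w by (rule mult_left_mono)
          also have "\<dots> = M1 * M2 * F x y"
            by (simp add: F_def trilinear_form_def w_def ac_simps)
          finally show ?case using w M F0[of x y] by (simp add: ennreal_mult[symmetric] ennreal_leI)
        qed
      qed
      finally show ?thesis .
    qed
    then have "(\<integral>\<^sup>+ x. T x * ennreal (pw (E x) (1 - 1 / q)) \<partial>lborel) \<le> (\<integral>\<^sup>+ x. \<integral>\<^sup>+ y. ennreal (M1 * M2) * ennreal (F x y) \<partial>lborel \<partial>lborel)"
      by (intro nn_integral_mono) auto
    also have "\<dots> = ennreal (M1 * M2) * (\<integral>\<^sup>+ x. \<integral>\<^sup>+ y. ennreal (F x y) \<partial>lborel \<partial>lborel)"
      by (simp add: nn_integral_cmult)
    also have "\<dots> \<le> ennreal (M1 * M2) * ennreal C"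
      unfolding F_def by (intro mult_left_mono tri E1 E2 E) simp
    also have "\<dots> = ennreal (C * (M1 * M2))" using C M by (simp add: ennreal_mult[symmetric] mult.commute)
    finally show ?thesis .
  qed
  have CM: "0 \<le> C * (M1 * M2)" using C M by simp
  note bound = powr_norm_bound_by_duality[OF q CM _ dual]
  have fin: "AE x in lborel. T x < \<infinity>" using bound(1) by simp
  have AEI: "AE x in lborel. integrable lborel (\<lambda>y. K (x - y) * f y) \<and> \<bar>conv f K x\<bar> * norm x powr (- \<beta>) \<le> enn2real (T x)"
    using fin AE_lborel_singleton[of "0::'a"]
  proof eventually_elim
    case (elim x)
    \<comment> \<open>Away from the origin the weight is positive, so finiteness passes from T to
      J.\<close>
    then have J: "J x < \<infinity>" by (auto simp: T_def ennreal_mult_less_top)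
    have Jeq: "J x = (\<integral>\<^sup>+ y. ennreal (norm (K (x - y) * f y)) \<partial>lborel)" by (simp add: J_def abs_mult)
    have int: "integrable lborel (\<lambda>y. K (x - y) * f y)"
      using J Jeq by (intro integrableI_bounded) auto
    have "ennreal \<bar>conv f K x\<bar> \<le> J x"
      using integral_norm_bound_ennreal[OF int] by (simp add: conv_def Jeq)
    then have "\<bar>conv f K x\<bar> \<le> enn2real (J x)"
      using J by (cases "J x") auto
    then have "\<bar>conv f K x\<bar> * norm x powr (- \<beta>) \<le> enn2real (T x)"
      by (simp add: T_def enn2real_mult mult.commute mult_right_mono)
    then show ?case using int by simp
  qed
  then show "AE x in lborel. integrable lborel (\<lambda>y. K (x - y) * f y)" by eventually_elim simp
  have "(\<integral>\<^sup>+ x. ennreal ((\<bar>conv f K x\<bar> * norm x powr (- \<beta>)) powr q) \<partial>lborel) \<le> (\<integral>\<^sup>+ x. ennreal (enn2real (T x) powr q) \<partial>lborel)"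
  proof (rule nn_integral_mono_AE)
    show "AE x in lborel. ennreal ((\<bar>conv f K x\<bar> * norm x powr (- \<beta>)) powr q) \<le> ennreal (enn2real (T x) powr q)"
      using AEI by eventually_elim (use q in \<open>auto intro!: ennreal_leI powr_mono2\<close>)
  qed
  also have "\<dots> \<le> ennreal ((C * (M1 * M2)) powr q)" using bound(2) by simp
  finally show "wnorm (ereal q) (- \<beta>) (conv f K) \<le> ennreal (C * (M1 * M2))"
    using q CM by (subst wnorm_le_iff) auto
qed

text \<open>With 1 - 1/q as the third density power, the standing assumption 1/q <= 1/p + 1/\<theta>
  says that the three powers add up to at least 1.\<close>

lemma conv_bound_sufficient:
  fixes p q \<alpha> \<beta> s :: real and \<theta> :: ereal
  defines "n \<equiv> real DIM('a::euclidean_space)"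
  assumes p: "1 < p" and q: "1 < q" and th: "1 < \<theta>" and le: "1 / q \<le> 1 / p + inv_exp \<theta>"
    and scal: "1 / q = 1 / p + inv_exp \<theta> + (\<alpha> + \<beta> + s) / n - 1"
    and \<alpha>: "\<alpha> < n * (1 - 1 / p)" and \<beta>: "\<beta> < n / q" and s: "s < n * (1 - inv_exp \<theta>)"
    and pairs: "0 \<le> \<alpha> + \<beta>" "0 \<le> \<alpha> + s" "0 \<le> \<beta> + s"
  shows "\<exists>C>0. \<forall>(f::'a \<Rightarrow> real) (K::'a \<Rightarrow> real).
            in_wL (ereal p) \<alpha> f \<and> in_wL \<theta> s K \<longrightarrow>
              (AE x in lborel. integrable lborel (\<lambda>y. K (x - y) * f y)) \<and>
              wnorm (ereal q) (- \<beta>) (conv f K) \<le> ennreal C * wnorm (ereal p) \<alpha> f * wnorm \<theta> s K"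
proof -
  have th': "0 \<le> inv_exp \<theta>" "inv_exp \<theta> < 1" using th by (cases \<theta>; simp add: inv_exp_def)+
  have "\<exists>C\<ge>0. \<forall>E1 E2 E3 :: 'a \<Rightarrow> real. unit_density E1 \<and> unit_density E2 \<and> unit_density E3 \<longrightarrow>
    (\<integral>\<^sup>+ x. \<integral>\<^sup>+ y. ennreal (trilinear_form \<alpha> s \<beta> (1 / p) (inv_exp \<theta>) (1 - 1 / q) E1 E2 E3 y (x - y)) \<partial>lborel \<partial>lborel) \<le> ennreal C"
  proof (rule trilinear_conv_bound)
    have q': "0 < 1 / q" "1 / q < 1" using q by auto
    show "0 \<le> 1 - 1 / q" "1 - 1 / q < 1" using q' by linarith+
    show "1 \<le> 1 / p + inv_exp \<theta> + (1 - 1 / q)" using le by linarith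
    show "1 / p + inv_exp \<theta> + (1 - 1 / q) + (\<alpha> + \<beta> + s) / real DIM('a) = 2"
      using scal unfolding n_def by linarith
    show "\<beta> < real DIM('a) * (1 - (1 - 1 / q))" using \<beta> by (simp add: n_def)
  qed (use p th' \<alpha> s pairs in \<open>auto simp: n_def\<close>)
  then obtain C where C: "0 \<le> C" and tri: "\<And>E1 E2 E3 :: 'a \<Rightarrow> real. unit_density E1 \<Longrightarrow> unit_density E2 \<Longrightarrow> unit_density E3 \<Longrightarrow>
    (\<integral>\<^sup>+ x. \<integral>\<^sup>+ y. ennreal (trilinear_form \<alpha> s \<beta> (1 / p) (inv_exp \<theta>) (1 - 1 / q) E1 E2 E3 y (x - y)) \<partial>lborel \<partial>lborel) \<le> ennreal C"
    by blast
  have "(AE x in lborel. integrable lborel (\<lambda>y. K (x - y) * f y)) \<and>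
        wnorm (ereal q) (- \<beta>) (conv f K) \<le> ennreal (C + 1) * wnorm (ereal p) \<alpha> f * wnorm \<theta> s K"
    if f: "in_wL (ereal p) \<alpha> f" and K: "in_wL \<theta> s K" for f K :: "'a \<Rightarrow> real"
  proof -
    have [measurable]: "f \<in> borel_measurable borel" "K \<in> borel_measurable borel"
      using f K by (auto simp: in_wL_def)
    obtain a where a: "0 \<le> a" "wnorm (ereal p) \<alpha> f = ennreal a"
      using f by (cases "wnorm (ereal p) \<alpha> f") (auto simp: in_wL_def)
    obtain b where b: "0 \<le> b" "wnorm \<theta> s K = ennreal b"
      using K by (cases "wnorm \<theta> s K") (auto simp: in_wL_def)
    \<comment> \<open>The norms a and b may be 0 although the normalisation divides by their bounds;
      a + e and b + e are used instead, and e tends to 0 afterwards.\<close>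
    have bnd: "(AE x in lborel. integrable lborel (\<lambda>y. K (x - y) * f y)) \<and>
        wnorm (ereal q) (- \<beta>) (conv f K) \<le> ennreal (C * ((a + e) * (b + e)))" if e: "0 < e" for e
      using conv_bound_normalized[OF p q th C tri, of f K "a + e" "b + e"] a b e
      by (simp add: add_nonneg_pos ennreal_leI del: ennreal_plus)
    obtain w where w: "0 \<le> w" "wnorm (ereal q) (- \<beta>) (conv f K) = ennreal w"
      using bnd[of 1] by (cases "wnorm (ereal q) (- \<beta>) (conv f K)") (auto simp: top_unique)
    have "((\<lambda>e. C * ((a + e) * (b + e))) \<longlongrightarrow> C * ((a + 0) * (b + 0))) (at_right 0)"
      by (intro tendsto_intros)
    moreover have "w \<le> C * ((a + e) * (b + e))" if "0 < e" for e
      using bnd[OF that] w C a(1) b(1) that by (simp add: ennreal_le_iff)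
    then have "eventually (\<lambda>e. w \<le> C * ((a + e) * (b + e))) (at_right 0)"
      by (auto simp: eventually_at_right_field intro!: exI[of _ 1])
    ultimately have "w \<le> C * ((a + 0) * (b + 0))"
      by (rule tendsto_lowerbound) simp
    also have "\<dots> \<le> (C + 1) * (a * b)" using a(1) b(1) by (simp add: distrib_right)
    finally have "ennreal w \<le> ennreal ((C + 1) * (a * b))" by (rule ennreal_leI)
    then show ?thesis using bnd[of 1] a b w C by (simp add: ennreal_mult mult.assoc del: ennreal_plus)
  qed
  \<comment> \<open>C is only nonnegative, whereas the constant has to be positive.\<close>
  then show ?thesis using C by (intro exI[of _ "C + 1"]) auto
qed

section \<open>Necessity\<close>

lemma wnorm_ge:
  fixes g :: "'a::euclidean_space \<Rightarrow> real"
  assumes q: "0 < q" and [measurable]: "S \<in> sets borel" and S: "emeasure lborel S = ennreal d" and d: "0 \<le> d"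
    and B: "0 \<le> B" "\<And>x. x \<in> S \<Longrightarrow> B \<le> \<bar>g x\<bar> * norm x powr t"
  shows "ennreal (B * d powr (1 / q)) \<le> wnorm (ereal q) t g"
proof (cases "wnorm (ereal q) t g")
  case (real w)
  have "ennreal (B powr q * d) = ennreal (B powr q) * emeasure lborel S"
    using d by (simp add: S ennreal_mult)
  also have "\<dots> = (\<integral>\<^sup>+ x. ennreal (B powr q) * indicator S x \<partial>lborel)"
    by (rule nn_integral_cmult_indicator[symmetric]) simp
  also have "\<dots> \<le> (\<integral>\<^sup>+ x. ennreal ((\<bar>g x\<bar> * norm x powr t) powr q) \<partial>lborel)"
    using B q by (intro nn_integral_mono) (auto simp: indicator_def intro!: ennreal_leI powr_mono2)
  also have "\<dots> \<le> ennreal (w powr q)"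
    using wnorm_le_iff[OF q real(1), of t g] real by simp
  finally have "B powr q * d \<le> w powr q" by simp
  then have "(B powr q * d) powr (1 / q) \<le> (w powr q) powr (1 / q)"
    using q d by (intro powr_mono2) auto
  then have "B * d powr (1 / q) \<le> w" using q B d real by (simp add: powr_mult powr_powr)
  then show ?thesis using real by (simp add: ennreal_leI)
qed simp

text \<open>Finite and infinite exponents are treated at once through \<open>inv_exp\<close>;
  positivity of d matters since \<open>d powr 0\<close> is 1 only for nonzero d.\<close>

lemma wnorm_le_of_bounded:
  fixes f :: "'a::euclidean_space \<Rightarrow> real"
  assumes th: "1 < \<theta>" and [measurable]: "f \<in> borel_measurable borel" "S \<in> sets borel"
    and S: "emeasure lborel S = ennreal d" and d: "0 < d"
    and B: "0 \<le> B" "\<And>x. x \<in> S \<Longrightarrow> \<bar>f x\<bar> * norm x powr t \<le> B" and out: "\<And>x. x \<notin> S \<Longrightarrow> f x = 0"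
  shows "wnorm \<theta> t f \<le> ennreal (B * d powr inv_exp \<theta>)"
proof (cases \<theta>)
  case (real p)
  have p: "1 < p" using th real by simp
  have "(\<integral>\<^sup>+ x. ennreal ((\<bar>f x\<bar> * norm x powr t) powr p) \<partial>lborel) \<le> (\<integral>\<^sup>+ x. ennreal (B powr p) * indicator S x \<partial>lborel)"
    using B out p by (intro nn_integral_mono) (auto simp: indicator_def intro!: ennreal_leI powr_mono2)
  also have "\<dots> = ennreal (B powr p) * emeasure lborel S"
    by (rule nn_integral_cmult_indicator) simp
  also have "\<dots> = ennreal ((B * d powr (1 / p)) powr p)"
    using B d p by (simp add: S ennreal_mult powr_mult powr_powr)
  finally have "wnorm (ereal p) t f \<le> ennreal (B * d powr (1 / p))"
    using p B by (subst wnorm_le_iff) auto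
  then show ?thesis using real by (simp add: inv_exp_def)
next
  case PInf
  have "esssup lborel (\<lambda>x. ennreal (\<bar>f x\<bar> * norm x powr t)) \<le> ennreal B"
  proof (rule esssup_I)
    have "ennreal (\<bar>f x\<bar> * norm x powr t) \<le> ennreal B" for x
      using B out by (cases "x \<in> S") (auto intro!: ennreal_leI)
    then show "AE x in lborel. ennreal (\<bar>f x\<bar> * norm x powr t) \<le> ennreal B" by simp
  qed measurable
  then show ?thesis using PInf d by (simp add: wnorm_def inv_exp_def)
next
  case MInf then show ?thesis using th by simp
qed

section \<open>Test functions supported in balls\<close>

lemma norm_powr_comparable_on_cball:
  fixes a x :: "'a::euclidean_space"
  assumes "x \<in> cball a r" "2 * r \<le> norm a" "0 < r"
  shows "norm x powr t \<le> 2 powr \<bar>t\<bar> * norm a powr t" "norm a powr t \<le> 2 powr \<bar>t\<bar> * norm x powr t"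
proof -
  have "norm (a - x) \<le> r" using assms by (simp add: dist_norm)
  then have "norm x \<le> 2 * norm a" "norm a \<le> 2 * norm x" "0 < norm a"
    using norm_triangle_ineq2[of a x] norm_triangle_ineq2[of x a] assms by (auto simp: norm_minus_commute)
  then show "norm x powr t \<le> 2 powr \<bar>t\<bar> * norm a powr t" "norm a powr t \<le> 2 powr \<bar>t\<bar> * norm x powr t"
    by (auto intro!: powr_comparable)
qed

lemma wnorm_indicator_cball_le:
  fixes a :: "'a::euclidean_space"
  assumes th: "1 < \<theta>" and r: "0 < r" "2 * r \<le> norm a"
  shows "wnorm \<theta> t (indicator (cball a r)) \<le>
    ennreal ((2 powr \<bar>t\<bar> * norm a powr t) * (unit_ball_vol (real DIM('a)) * r powr real DIM('a)) powr inv_exp \<theta>)"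
proof (rule wnorm_le_of_bounded[OF th, where S = "cball a r"])
  show "emeasure lborel (cball a r) = ennreal (unit_ball_vol (real DIM('a)) * r powr real DIM('a))"
    using r by (intro emeasure_cball_powr) simp
  show "\<bar>indicator (cball a r) x\<bar> * norm x powr t \<le> 2 powr \<bar>t\<bar> * norm a powr t" if "x \<in> cball a r" for x
    using norm_powr_comparable_on_cball(1)[OF that r(2,1), of t] that by simp
qed (use r in auto)

text \<open>A power inequality along the integers orders the exponents. The start at 6 keeps N - 2
  comparable with N in the applications.\<close>

lemma powr_growth:
  fixes u v c :: real
  assumes "\<And>N::nat. 6 \<le> N \<Longrightarrow> real N powr u \<le> c * real N powr v"
  shows "u \<le> v"
proof (rule ccontr)
  assume "\<not> u \<le> v"
  then have uv: "0 < u - v" by simp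
  obtain N :: nat where N: "max 6 ((\<bar>c\<bar> + 1) powr (1 / (u - v))) \<le> real N" using real_arch_simple by blast
  have "((\<bar>c\<bar> + 1) powr (1 / (u - v))) powr (u - v) \<le> real N powr (u - v)"
    using N uv by (intro powr_mono2) auto
  then have "\<bar>c\<bar> + 1 \<le> real N powr (u - v)" using uv by (simp add: powr_powr)
  moreover have "real N powr (u - v) \<le> c"
    using assms[of N] N by (simp add: powr_diff field_simps)
  ultimately show False by linarith
qed

lemma conv_eq_integral_left:
  fixes f K :: "'a::euclidean_space \<Rightarrow> real"
  assumes "\<And>y. f y \<noteq> 0 \<Longrightarrow> K (x - y) = 1"
  shows "conv f K x = (\<integral> y. f y \<partial>lborel)"
proof -
  have "K (x - y) * f y = f y" for y using assms[of y] by (cases "f y = 0") auto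
  then show ?thesis by (simp only: conv_def)
qed

lemma conv_eq_integral_right:
  fixes f K :: "'a::euclidean_space \<Rightarrow> real"
  assumes [measurable]: "K \<in> borel_measurable borel" and "\<And>w. K w \<noteq> 0 \<Longrightarrow> f (x - w) = 1"
  shows "conv f K x = (\<integral> y. K y \<partial>lborel)"
proof -
  have "K (x - y) * f y = K (x - y)" for y using assms(2)[of "x - y"] by (cases "K (x - y) = 0") auto
  then have "conv f K x = (\<integral> y. K (x - y) \<partial>lborel)" by (simp only: conv_def)
  also have "\<dots> = (\<integral> y. K y \<partial>distr lborel borel (\<lambda>y. x - y))" by (simp add: integral_distr)
  finally show ?thesis by (simp add: lborel_distr_minus)
qed

lemma integral_indicator_cball:
  fixes a :: "'a::euclidean_space"
  assumes "0 < r"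
  shows "(\<integral> y. indicator (cball a r) y \<partial>lborel) = unit_ball_vol (real DIM('a)) * r powr real DIM('a)"
  using assms by (simp add: measure_def emeasure_cball_powr)

section \<open>The logarithmically divergent power on dyadic shells\<close>

definition dyadic_shell :: "nat \<Rightarrow> 'a::euclidean_space set" where
  "dyadic_shell N = {x. (1 / 2) ^ N < norm x \<and> norm x \<le> 1}"

lemma dyadic_shell_measurable [measurable]: "dyadic_shell N \<in> sets borel"
  unfolding dyadic_shell_def by measurable

text \<open>The shell is a union of N annuli with radii r/2 and r, on which |x|^(-n) lies between
  r^(-n) and (r/2)^(-n). As n >= 1, each annulus has at least half the measure of its outer ball, so
  all of them contribute amounts between the same two positive constants.\<close>

lemma nn_integral_dyadic_shell:
  fixes N :: nat
  defines "n \<equiv> real DIM('a::euclidean_space)"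
  shows "ennreal (unit_ball_vol n / 2 * real N) \<le> (\<integral>\<^sup>+ x. ennreal (norm x powr (- n)) * indicator (dyadic_shell N) (x::'a) \<partial>lborel)"
    and "(\<integral>\<^sup>+ x. ennreal (norm x powr (- n)) * indicator (dyadic_shell N) (x::'a) \<partial>lborel) \<le> ennreal (2 powr n * unit_ball_vol n * real N)"
proof -
  define w where "w = unit_ball_vol n"
  have w: "0 \<le> w" by (simp add: w_def n_def)
  have n: "1 \<le> n" by (simp add: n_def DIM_positive Suc_leI)
  define J where "J N = (\<integral>\<^sup>+ x. ennreal (norm x powr (- n)) * indicator (dyadic_shell N) (x::'a) \<partial>lborel)" for N
  define A where "A N = cball (0::'a) ((1 / 2) ^ N) - cball 0 ((1 / 2) ^ Suc N)" for N
  have [measurable]: "A N \<in> sets borel" for N unfolding A_def by measurable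
  have A_iff: "x \<in> A N \<longleftrightarrow> (1 / 2) ^ Suc N < norm x \<and> norm x \<le> (1 / 2) ^ N" for x N
    by (auto simp: A_def)
  have step: "J (Suc N) = J N + (\<integral>\<^sup>+ x. ennreal (norm x powr (- n)) * indicator (A N) x \<partial>lborel)" for N
  proof -
    have le: "(1 / 2 :: real) ^ Suc N \<le> (1 / 2) ^ N" "(1 / 2 :: real) ^ N \<le> 1" by (auto simp: power_le_one)
    have ind: "indicator (dyadic_shell (Suc N)) x = (indicator (dyadic_shell N) x + indicator (A N) x :: ennreal)" for x :: 'a
      using le unfolding indicator_def A_iff dyadic_shell_def mem_Collect_eq
      by (cases "(1 / 2) ^ N < norm x") (auto simp del: power_Suc intro: le_less_trans[OF le(1)] order_trans[OF _ le(2)])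
    show ?thesis unfolding J_def
      by (subst nn_integral_add[symmetric], measurable) (simp add: ind distrib_left)
  qed
  have A: "ennreal (w / 2) \<le> (\<integral>\<^sup>+ x. ennreal (norm x powr (- n)) * indicator (A N) x \<partial>lborel)"
    "(\<integral>\<^sup>+ x. ennreal (norm x powr (- n)) * indicator (A N) x \<partial>lborel) \<le> ennreal (2 powr n * w)" for N
  proof -
    define r where "r = (1 / 2 :: real) ^ N"
    have r: "0 < r" by (simp add: r_def)
    have Ar: "A N = cball 0 r - cball 0 (r / 2)" by (simp add: A_def r_def)
    have em: "emeasure lborel (A N) = ennreal (w * r powr n - w * (r / 2) powr n)"
    proof -
      have "emeasure lborel (A N) = emeasure lborel (cball (0::'a) r) - emeasure lborel (cball (0::'a) (r / 2))"
        unfolding Ar using r by (intro emeasure_Diff) (auto simp: emeasure_cball)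
      also have "\<dots> = ennreal (w * r powr n) - ennreal (w * (r / 2) powr n)"
        using r by (simp add: emeasure_cball_powr w_def n_def)
      also have "\<dots> = ennreal (w * r powr n - w * (r / 2) powr n)"
        using w by (intro ennreal_minus) simp
      finally show ?thesis .
    qed
    have half: "(r / 2) powr n \<le> r powr n / 2"
    proof -
      have "2 powr 1 \<le> 2 powr n" using n by (intro powr_mono) auto
      then have "r powr n / 2 powr n \<le> r powr n / 2" by (intro divide_left_mono) auto
      then show ?thesis by (simp only: powr_divide)
    qed
    have rn: "r powr (- n) * r powr n = 1" using r by (simp add: powr_minus)
    have "ennreal (w / 2) \<le> ennreal (r powr (- n)) * emeasure lborel (A N)"
    proof -
      have "w / 2 = r powr (- n) * (w * (r powr n / 2))"
        using rn by (simp add: algebra_simps)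
      also have half': "w * (r powr n / 2) \<le> w * r powr n - w * (r / 2) powr n"
        using mult_left_mono[OF half w] by (simp add: algebra_simps)
      finally have "w / 2 \<le> r powr (- n) * (w * r powr n - w * (r / 2) powr n)"
        by (simp add: mult_left_mono)
      moreover have "0 \<le> w * r powr n - w * (r / 2) powr n"
        using w by (intro order_trans[OF _ half']) simp
      ultimately show ?thesis unfolding em by (subst ennreal_mult''[symmetric]) (auto simp: ennreal_leI)
    qed
    also have "\<dots> = (\<integral>\<^sup>+ x. ennreal (r powr (- n)) * indicator (A N) x \<partial>lborel)"
      by (rule nn_integral_cmult_indicator[symmetric]) simp
    also have "\<dots> \<le> (\<integral>\<^sup>+ x. ennreal (norm x powr (- n)) * indicator (A N) x \<partial>lborel)"
    proof (rule nn_integral_mono)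
      fix x :: 'a
      have "0 < norm x" if "x \<in> A N" using that r by (auto simp: A_iff r_def intro: less_trans[rotated])
      then show "ennreal (r powr (- n)) * indicator (A N) x \<le> ennreal (norm x powr (- n)) * indicator (A N) x"
        using n by (auto simp: indicator_def A_iff r_def intro!: ennreal_leI powr_mono2')
    qed
    finally show "ennreal (w / 2) \<le> (\<integral>\<^sup>+ x. ennreal (norm x powr (- n)) * indicator (A N) x \<partial>lborel)" .
    have "(\<integral>\<^sup>+ x. ennreal (norm x powr (- n)) * indicator (A N) x \<partial>lborel) \<le>
        (\<integral>\<^sup>+ x. ennreal ((r / 2) powr (- n)) * indicator (cball 0 r) x \<partial>(lborel :: 'a measure))"
    proof (rule nn_integral_mono)
      fix x :: 'a
      show "ennreal (norm x powr (- n)) * indicator (A N) x \<le> ennreal ((r / 2) powr (- n)) * indicator (cball 0 r) x"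
        using r n by (auto simp: indicator_def A_iff r_def intro!: ennreal_leI powr_mono2')
    qed
    also have "\<dots> = ennreal ((r / 2) powr (- n)) * emeasure lborel (cball (0::'a) r)"
      by (rule nn_integral_cmult_indicator) simp
    also have "\<dots> = ennreal ((r / 2) powr (- n) * (w * r powr n))"
      using r w by (simp add: emeasure_cball_powr ennreal_mult w_def n_def)
    also have "(r / 2) powr (- n) * (w * r powr n) = 2 powr n * w"
      using r by (simp add: powr_divide powr_minus field_simps)
    finally show "(\<integral>\<^sup>+ x. ennreal (norm x powr (- n)) * indicator (A N) x \<partial>lborel) \<le> ennreal (2 powr n * w)" .
  qed
  have J: "ennreal (w / 2 * real N) \<le> J N \<and> J N \<le> ennreal (2 powr n * w * real N)"
  proof (induction N)
    case 0
    have "dyadic_shell 0 = ({} :: 'a set)" by (auto simp: dyadic_shell_def)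
    then show ?case by (simp add: J_def)
  next
    case (Suc N)
    have 1: "ennreal (w / 2 * real (Suc N)) = ennreal (w / 2 * real N) + ennreal (w / 2)"
      using w by (simp add: distrib_left add_divide_distrib add.commute)
    have 2: "ennreal (2 powr n * w * real (Suc N)) = ennreal (2 powr n * w * real N) + ennreal (2 powr n * w)"
      using w by (simp add: distrib_left add_divide_distrib add.commute)
    show ?case unfolding step 1 2 using Suc A[of N] by (auto intro!: add_mono)
  qed
  then show "ennreal (unit_ball_vol n / 2 * real N) \<le> (\<integral>\<^sup>+ x. ennreal (norm x powr (- n)) * indicator (dyadic_shell N) (x::'a) \<partial>lborel)"
    "(\<integral>\<^sup>+ x. ennreal (norm x powr (- n)) * indicator (dyadic_shell N) (x::'a) \<partial>lborel) \<le> ennreal (2 powr n * unit_ball_vol n * real N)"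
    by (auto simp: J_def w_def)
qed

text \<open>The setting for necessity: a convolution inequality is assumed and each condition is
  derived from it. The parameter of type \<open>itself\<close> keeps the space \<open>'a\<close>
  among the parameters, the remaining ones being numbers.\<close>

locale weighted_conv_bound =
  fixes p q \<alpha> \<beta> s C n \<omega> :: real and \<theta> :: ereal and a_type :: "'a::euclidean_space itself"
  defines n_def: "n \<equiv> real DIM('a)" and \<omega>_def: "\<omega> \<equiv> unit_ball_vol n"
  assumes p: "1 < p" and q: "1 < q" and th: "1 < \<theta>"
    and bound: "\<And>f K :: 'a \<Rightarrow> real. in_wL (ereal p) \<alpha> f \<Longrightarrow> in_wL \<theta> s K \<Longrightarrow>
      wnorm (ereal q) (- \<beta>) (conv f K) \<le> ennreal C * wnorm (ereal p) \<alpha> f * wnorm \<theta> s K"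
    and C: "0 < C"
begin

section \<open>Testing an assumed inequality\<close>

lemma dim_pos [simp]: "0 < n" "n \<noteq> 0"
  by (auto simp: n_def)

lemma ball_vol_pos [simp]: "0 < \<omega>"
  by (simp add: \<omega>_def n_def)

lemma ball_vol_nonneg [simp]: "0 \<le> \<omega>" "\<omega> \<noteq> 0"
  using ball_vol_pos by linarith+

text \<open>Cited by position below: 1 is the measure of a ball, 2 the norm of its indicator, 3 the
  integral of its indicator, 4 and 5 the lower and upper shell integrals.\<close>

lemmas dim_folded =
  emeasure_cball_powr[where 'a='a, folded n_def, folded \<omega>_def]
  wnorm_indicator_cball_le[where 'a='a, folded n_def, folded \<omega>_def]
  integral_indicator_cball[where 'a='a, folded n_def, folded \<omega>_def]
  nn_integral_dyadic_shell[where 'a='a, folded n_def, folded \<omega>_def]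

lemma p': "1 < ereal p" and inv_exp_p: "inv_exp (ereal p) = 1 / p"
  using p by (auto simp: inv_exp_def)

lemma inv_exp_bounds: "0 \<le> inv_exp \<theta>" "inv_exp \<theta> < 1"
  using th by (cases \<theta>; simp add: inv_exp_def)+

lemma wnorm_conv_le:
  fixes f K :: "'a \<Rightarrow> real"
  assumes [measurable]: "f \<in> borel_measurable borel" "K \<in> borel_measurable borel"
    and M: "0 \<le> M1" "0 \<le> M2" and f: "wnorm (ereal p) \<alpha> f \<le> ennreal M1" and K: "wnorm \<theta> s K \<le> ennreal M2"
  shows "wnorm (ereal q) (- \<beta>) (conv f K) \<le> ennreal (C * M1 * M2)"
proof -
  have "in_wL (ereal p) \<alpha> f" "in_wL \<theta> s K"
    using f K by (auto simp: in_wL_def intro: le_less_trans)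
  then have "wnorm (ereal q) (- \<beta>) (conv f K) \<le> ennreal C * wnorm (ereal p) \<alpha> f * wnorm \<theta> s K"
    by (rule bound)
  also have "\<dots> \<le> ennreal C * ennreal M1 * ennreal M2"
    using f K by (intro mult_mono) auto
  also have "\<dots> = ennreal (C * M1 * M2)" using C M by (simp add: ennreal_mult)
  finally show ?thesis .
qed

text \<open>On a ball at distance from the origin the output weight is comparable to its value at
  the centre, with loss 2^|\<beta>|. A constant value m of the convolution there bounds its norm
  from below by explicit powers.\<close>

lemma conv_test:
  fixes f K :: "'a \<Rightarrow> real"
  assumes "f \<in> borel_measurable borel" "K \<in> borel_measurable borel"
    and M: "0 \<le> M1" "0 \<le> M2" and "wnorm (ereal p) \<alpha> f \<le> ennreal M1" "wnorm \<theta> s K \<le> ennreal M2"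
    and r: "0 < r" "2 * r \<le> norm a" and m: "0 \<le> m" "\<And>x. x \<in> cball a r \<Longrightarrow> conv f K x = m"
  shows "m * norm a powr (- \<beta>) * (\<omega> * r powr n) powr (1 / q) \<le> 2 powr \<bar>\<beta>\<bar> * C * M1 * M2"
proof -
  have "ennreal ((m * (norm a powr (- \<beta>) / 2 powr \<bar>\<beta>\<bar>)) * (\<omega> * r powr n) powr (1 / q)) \<le> wnorm (ereal q) (- \<beta>) (conv f K)"
  proof (rule wnorm_ge[where S = "cball a r"])
    show "emeasure lborel (cball a r) = ennreal (\<omega> * r powr n)" using r by (intro dim_folded) simp
    fix x assume x: "x \<in> cball a r"
    have le: "norm a powr (- \<beta>) / 2 powr \<bar>\<beta>\<bar> \<le> norm x powr (- \<beta>)"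
      using norm_powr_comparable_on_cball(2)[OF x r(2,1), of "- \<beta>"] by (simp add: field_simps)
    show "m * (norm a powr (- \<beta>) / 2 powr \<bar>\<beta>\<bar>) \<le> \<bar>conv f K x\<bar> * norm x powr (- \<beta>)"
      using mult_left_mono[OF le m(1)] m x by simp
  qed (use q r m in auto)
  also have "\<dots> \<le> ennreal (C * M1 * M2)" using assms by (intro wnorm_conv_le)
  finally have "(m * (norm a powr (- \<beta>) / 2 powr \<bar>\<beta>\<bar>)) * (\<omega> * r powr n) powr (1 / q) \<le> C * M1 * M2"
    using C M by simp
  then show ?thesis by (simp add: field_simps)
qed

text \<open>f is the indicator of the ball of radius l/2 around a, K that of radius l around b. By
  the triangle inequality the convolution equals the measure of the first ball on the whole ball of
  radius l/2 around a + b. The constant c does not depend on l, a, b, which are varied separately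
  later.\<close>

lemma ball_test:
  "\<exists>c>0. \<forall>l>0. \<forall>a b :: 'a. 2 * l \<le> norm a \<longrightarrow> 2 * l \<le> norm b \<longrightarrow> 2 * l \<le> norm (a + b) \<longrightarrow>
     l powr (n + n / q) * norm (a + b) powr (- \<beta>) \<le> c * l powr (n / p + n * inv_exp \<theta>) * norm a powr \<alpha> * norm b powr s"
proof -
  \<comment> \<open>A ball of radius l/2 has measure h l^n.\<close>
  define h where "h = \<omega> * (1 / 2) powr n"
  have h: "0 < h" by (simp add: h_def)
  have w: "0 < \<omega>" by simp
  define c where "c = (2 powr \<bar>\<beta>\<bar> * C * (2 powr \<bar>\<alpha>\<bar> * h powr (1 / p)) * (2 powr \<bar>s\<bar> * \<omega> powr inv_exp \<theta>)) / (h * h powr (1 / q))"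
  have c: "0 < c" using C h w by (simp add: c_def)
  have "l powr (n + n / q) * norm (a + b) powr (- \<beta>) \<le> c * l powr (n / p + n * inv_exp \<theta>) * norm a powr \<alpha> * norm b powr s"
    if l: "0 < l" and ab: "2 * l \<le> norm a" "2 * l \<le> norm b" "2 * l \<le> norm (a + b)" for l and a b :: 'a
  proof -
    have hl: "\<omega> * (l / 2) powr n = h * l powr n" using l by (simp add: h_def powr_divide)
    have "(h * l powr n) * norm (a + b) powr (- \<beta>) * (h * l powr n) powr (1 / q) \<le>
       2 powr \<bar>\<beta>\<bar> * C * ((2 powr \<bar>\<alpha>\<bar> * norm a powr \<alpha>) * (h * l powr n) powr (1 / p)) *
       ((2 powr \<bar>s\<bar> * norm b powr s) * (\<omega> * l powr n) powr inv_exp \<theta>)"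
      unfolding hl[symmetric]
    proof (rule conv_test)
      show "wnorm (ereal p) \<alpha> (indicator (cball a (l / 2))) \<le> ennreal ((2 powr \<bar>\<alpha>\<bar> * norm a powr \<alpha>) * (\<omega> * (l / 2) powr n) powr (1 / p))"
        using dim_folded(2)[OF p', of "l / 2" a \<alpha>] l ab unfolding inv_exp_p by simp
      show "wnorm \<theta> s (indicator (cball b l)) \<le> ennreal ((2 powr \<bar>s\<bar> * norm b powr s) * (\<omega> * l powr n) powr inv_exp \<theta>)"
        using dim_folded(2)[OF th, of l b s] l ab by simp
      fix x assume x: "x \<in> cball (a + b) (l / 2)"
      have "x - y \<in> cball b l" if "y \<in> cball a (l / 2)" for y
      proof -
        have "b - (x - y) = (a + b - x) - (a - y)" by simp
        then have "norm (b - (x - y)) \<le> norm (a + b - x) + norm (a - y)" by (metis norm_triangle_ineq4)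
        then show ?thesis using x that by (simp add: dist_norm)
      qed
      then have "conv (indicator (cball a (l / 2))) (indicator (cball b l)) x = (\<integral> y. indicator (cball a (l / 2)) y \<partial>lborel)"
        by (intro conv_eq_integral_left) (auto simp: indicator_def)
      also have "\<dots> = \<omega> * (l / 2) powr n" using l by (intro dim_folded(3)) simp
      finally show "conv (indicator (cball a (l / 2))) (indicator (cball b l)) x = \<omega> * (l / 2) powr n" .
    qed (use l ab in auto)
    then have "(h * h powr (1 / q)) * (l powr (n + n / q) * norm (a + b) powr (- \<beta>)) \<le>
       (h * h powr (1 / q)) * (c * l powr (n / p + n * inv_exp \<theta>) * norm a powr \<alpha> * norm b powr s)"
      using l h w by (simp add: c_def powr_mult powr_powr powr_add ac_simps)
    moreover have "0 < h * h powr (1 / q)" using h by simp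
    ultimately show ?thesis by (simp only: mult_le_cancel_left_pos)
  qed
  then show ?thesis using c by blast
qed

text \<open>Points on one line make the three norms explicit. With l = 1, two of them grow like N
  while the third stays at 2, which compares the two weights involved. With all three proportional
  to l, large and small l together force the scaling identity.\<close>

lemma pair_sums: "0 \<le> \<alpha> + \<beta>" "0 \<le> \<alpha> + s" "0 \<le> \<beta> + s"
  and scaling: "1 / q = 1 / p + inv_exp \<theta> + (\<alpha> + \<beta> + s) / n - 1"
proof -
  obtain c where c: "0 < c" and t: "\<And>l (a::'a) b. 0 < l \<Longrightarrow> 2 * l \<le> norm a \<Longrightarrow> 2 * l \<le> norm b \<Longrightarrow> 2 * l \<le> norm (a + b) \<Longrightarrow>
     l powr (n + n / q) * norm (a + b) powr (- \<beta>) \<le> c * l powr (n / p + n * inv_exp \<theta>) * norm a powr \<alpha> * norm b powr s"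
    using ball_test by blast
  obtain e :: 'a where e: "norm e = 1" using norm_Basis SOME_Basis by blast
  have ne: "norm (x *\<^sub>R e) = \<bar>x\<bar>" for x using e by simp
  have t': "l powr (n + n / q) * \<bar>x + y\<bar> powr (- \<beta>) \<le> c * l powr (n / p + n * inv_exp \<theta>) * \<bar>x\<bar> powr \<alpha> * \<bar>y\<bar> powr s"
    if "0 < l" "2 * l \<le> \<bar>x\<bar>" "2 * l \<le> \<bar>y\<bar>" "2 * l \<le> \<bar>x + y\<bar>" for l x y
    using t[of l "x *\<^sub>R e" "y *\<^sub>R e"] that unfolding scaleR_add_left[symmetric] ne by blast
  \<comment> \<open>Points N and 2 with sum N + 2: the support of K stays at bounded
    distance.\<close>
  have "- \<beta> \<le> \<alpha>"
  proof (rule powr_growth)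
    fix N :: nat assume N: "6 \<le> N"
    have "real N powr (- \<beta>) \<le> 2 powr \<bar>- \<beta>\<bar> * (real N + 2) powr (- \<beta>)"
      using N by (intro powr_comparable) auto
    also have "(real N + 2) powr (- \<beta>) \<le> c * real N powr \<alpha> * 2 powr s"
      using t'[of 1 "real N" 2] N by simp
    finally show "real N powr (- \<beta>) \<le> (2 powr \<bar>- \<beta>\<bar> * c * 2 powr s) * real N powr \<alpha>"
      by (simp add: ac_simps)
  qed
  then show "0 \<le> \<alpha> + \<beta>" by simp
  \<comment> \<open>Points 2 and N with sum N + 2: now the support of f stays at bounded
    distance.\<close>
  have "- \<beta> \<le> s"
  proof (rule powr_growth)
    fix N :: nat assume N: "6 \<le> N"
    have "real N powr (- \<beta>) \<le> 2 powr \<bar>- \<beta>\<bar> * (2 + real N) powr (- \<beta>)"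
      using N by (intro powr_comparable) auto
    also have "(2 + real N) powr (- \<beta>) \<le> c * 2 powr \<alpha> * real N powr s"
      using t'[of 1 2 "real N"] N by simp
    finally show "real N powr (- \<beta>) \<le> (2 powr \<bar>- \<beta>\<bar> * c * 2 powr \<alpha>) * real N powr s"
      by (simp add: ac_simps)
  qed
  then show "0 \<le> \<beta> + s" by simp
  \<comment> \<open>Points N and 2 - N with sum 2: the output stays at bounded distance.\<close>
  have "0 \<le> \<alpha> + s"
  proof (rule powr_growth)
    fix N :: nat assume N: "6 \<le> N"
    have "2 powr (- \<beta>) \<le> c * real N powr \<alpha> * (real N - 2) powr s"
      using t'[of 1 "real N" "2 - real N"] N by (simp add: abs_if split: if_splits)
    also have "(real N - 2) powr s \<le> 2 powr \<bar>s\<bar> * real N powr s"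
      using N by (intro powr_comparable) auto
    finally have "2 powr (- \<beta>) \<le> c * real N powr \<alpha> * (2 powr \<bar>s\<bar> * real N powr s)"
      using c by (simp add: mult_left_mono)
    then show "real N powr 0 \<le> (c * 2 powr \<bar>s\<bar> * 2 powr \<beta>) * real N powr (\<alpha> + s)"
      using N by (simp add: powr_minus powr_add field_simps)
  qed
  then show "0 \<le> \<alpha> + s" .
  \<comment> \<open>Points 2l and 2l with sum 4l, so that only the dilation varies.\<close>
  have sc: "l powr (n + n / q - \<beta>) \<le> (c * 2 powr \<alpha> * 2 powr s * 4 powr \<beta>) * l powr (n / p + n * inv_exp \<theta> + \<alpha> + s)"
    if l: "0 < l" for l
  proof -
    have "l powr (n + n / q) * (4 * l) powr (- \<beta>) \<le> c * l powr (n / p + n * inv_exp \<theta>) * (2 * l) powr \<alpha> * (2 * l) powr s"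
      using t'[of l "2 * l" "2 * l"] l by simp
    then have "l powr (n + n / q) * (4 * l) powr (- \<beta>) * 4 powr \<beta> \<le> c * l powr (n / p + n * inv_exp \<theta>) * (2 * l) powr \<alpha> * (2 * l) powr s * 4 powr \<beta>"
      by (rule mult_right_mono) simp
    moreover have "(4 * l) powr (- \<beta>) * 4 powr \<beta> = l powr (- \<beta>)"
    proof -
      have "(4 * l) powr (- \<beta>) * 4 powr \<beta> = l powr (- \<beta>) * (4 powr (- \<beta>) * 4 powr \<beta>)"
        by (simp only: powr_mult ac_simps)
      also have "4 powr (- \<beta>) * 4 powr \<beta> = 1" by (simp only: powr_add[symmetric]) simp
      finally show ?thesis by simp
    qed
    ultimately have "l powr (n + n / q) * l powr (- \<beta>) \<le> (c * 2 powr \<alpha> * 2 powr s * 4 powr \<beta>) * (l powr (n / p + n * inv_exp \<theta>) * l powr \<alpha> * l powr s)"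
      by (simp only: mult.assoc powr_mult) (simp only: ac_simps)
    then show ?thesis by (simp add: powr_add[symmetric])
  qed
  have "n + n / q - \<beta> \<le> n / p + n * inv_exp \<theta> + \<alpha> + s"
    by (rule powr_growth, rule sc) simp
  \<comment> \<open>The dilations 1/N give the opposite comparison of exponents.\<close>
  moreover have "- (n + n / q - \<beta>) \<le> - (n / p + n * inv_exp \<theta> + \<alpha> + s)"
  proof (rule powr_growth)
    fix N :: nat assume N: "6 \<le> N"
    have inv: "inverse (real N) powr u = real N powr (- u)" for u
      by (simp add: powr_minus inverse_powr)
    show "real N powr (- (n + n / q - \<beta>)) \<le> (c * 2 powr \<alpha> * 2 powr s * 4 powr \<beta>) * real N powr (- (n / p + n * inv_exp \<theta> + \<alpha> + s))"
      using sc[of "inverse (real N)"] N unfolding inv by simp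
  qed
  ultimately have "n + n / q - \<beta> = n / p + n * inv_exp \<theta> + \<alpha> + s" by linarith
  moreover have "0 < n" by simp
  ultimately show "1 / q = 1 / p + inv_exp \<theta> + (\<alpha> + \<beta> + s) / n - 1"
    by (simp add: field_simps)
qed

text \<open>For a finite exponent r the condition on t says (t - n) r >= -n. Since |x| <= 1 on the
  shell, the r-th power of the weighted function is at most |x|^(-n), whose integral is of order
  N.\<close>

lemma wnorm_shell_le:
  assumes th: "1 < \<tau>" and t: "n * (1 - inv_exp \<tau>) \<le> t" and N: "1 \<le> N"
  shows "wnorm \<tau> t (\<lambda>x::'a. norm x powr (- n) * indicator (dyadic_shell N) x) \<le> ennreal ((2 powr n * \<omega> * real N) powr inv_exp \<tau>)"
proof (cases \<tau>)
  case (real r)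
  have r: "1 < r" using th real by simp
  have "(\<integral>\<^sup>+ x. ennreal ((\<bar>norm x powr (- n) * indicator (dyadic_shell N) x\<bar> * norm x powr t) powr r) \<partial>(lborel :: 'a measure))
     \<le> (\<integral>\<^sup>+ x. ennreal (norm x powr (- n)) * indicator (dyadic_shell N) (x::'a) \<partial>lborel)"
  proof (rule nn_integral_mono)
    fix x :: 'a
    show "ennreal ((\<bar>norm x powr (- n) * indicator (dyadic_shell N) x\<bar> * norm x powr t) powr r) \<le> ennreal (norm x powr (- n)) * indicator (dyadic_shell N) x"
    proof (cases "x \<in> dyadic_shell N")
      case True
      then have x: "0 < norm x" "norm x \<le> 1" by (auto simp: dyadic_shell_def intro: less_trans[rotated])
      have "(norm x powr (- n) * norm x powr t) powr r = norm x powr ((- n + t) * r)"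
        by (simp only: powr_add[symmetric] powr_powr)
      also have "\<dots> \<le> norm x powr (- n)"
      proof (rule powr_mono')
        have "n * (1 - 1 / r) * r \<le> t * r" using t r real by (intro mult_right_mono) (auto simp: inv_exp_def)
        moreover have "(1 - 1 / r) * r = r - 1" using r by (simp add: field_simps)
        ultimately have "n * (r - 1) \<le> t * r" by (simp only: mult.assoc)
        then show "- n \<le> (- n + t) * r" by (simp add: algebra_simps)
      qed (use x in auto)
      finally show ?thesis using True by (simp add: ennreal_leI)
    qed simp
  qed
  also have "\<dots> \<le> ennreal (2 powr n * \<omega> * real N)" by (rule dim_folded(4,5))
  also have "\<dots> = ennreal (((2 powr n * \<omega> * real N) powr (1 / r)) powr r)"
    using r by (simp add: powr_powr)
  finally have "wnorm (ereal r) t (\<lambda>x::'a. norm x powr (- n) * indicator (dyadic_shell N) x) \<le> ennreal ((2 powr n * \<omega> * real N) powr (1 / r))"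
    using r by (subst wnorm_le_iff) auto
  then show ?thesis using real by (simp add: inv_exp_def)
next
  case PInf
  have "wnorm \<tau> t (\<lambda>x::'a. norm x powr (- n) * indicator (dyadic_shell N) x) \<le> ennreal (1 * \<omega> powr inv_exp \<tau>)"
  proof (rule wnorm_le_of_bounded[OF th, where S = "cball 0 1"])
    show "emeasure lborel (cball (0::'a) 1) = ennreal \<omega>" by (simp add: dim_folded(1))
    fix x :: 'a
    show "\<bar>norm x powr (- n) * indicator (dyadic_shell N) x\<bar> * norm x powr t \<le> 1"
    proof (cases "x \<in> dyadic_shell N")
      case True
      then have x: "0 < norm x" "norm x \<le> 1" by (auto simp: dyadic_shell_def intro: less_trans[rotated])
      have "norm x powr (- n) * norm x powr t = norm x powr (- n + t)" by (simp only: powr_add)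
      also have "\<dots> \<le> 1" using x t PInf by (intro powr_le1) (auto simp: inv_exp_def)
      finally show ?thesis using True by simp
    qed simp
  qed (auto simp: dyadic_shell_def)
  \<comment> \<open>With \<open>inv_exp\<close> equal to 0 both powers are 1; N >= 1 keeps the base
    positive, as \<open>0 powr 0\<close> is 0.\<close>
  then show ?thesis using PInf N by (simp add: inv_exp_def)
next
  case MInf then show ?thesis using th by simp
qed

lemma integral_shell_ge:
  "\<omega> / 2 * real N \<le> (\<integral> x. norm x powr (- n) * indicator (dyadic_shell N) (x::'a) \<partial>lborel)"
proof -
  have eq: "(\<integral>\<^sup>+ x. ennreal (norm x powr (- n) * indicator (dyadic_shell N) (x::'a)) \<partial>lborel) =
      (\<integral>\<^sup>+ x. ennreal (norm x powr (- n)) * indicator (dyadic_shell N) (x::'a) \<partial>lborel)"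
    by (intro nn_integral_cong) (simp add: ennreal_mult indicator_def)
  have "(\<integral> x. norm x powr (- n) * indicator (dyadic_shell N) (x::'a) \<partial>lborel) =
    enn2real (\<integral>\<^sup>+ x. ennreal (norm x powr (- n)) * indicator (dyadic_shell N) (x::'a) \<partial>lborel)"
    unfolding eq[symmetric] by (rule integral_eq_nn_integral) auto
  also have "\<dots> \<ge> enn2real (ennreal (\<omega> / 2 * real N))"
    using dim_folded(4,5)[of N] by (intro enn2real_mono) (auto intro: le_less_trans)
  finally show ?thesis by (subst (asm) enn2real_ennreal) auto
qed

text \<open>If the condition on one function fails, this function is taken to be |x|^(-n) on the
  shell and the other the indicator of a ball of radius 2. Near the centre of that ball the
  convolution is the integral of the first function and grows like N, while the norms allow only
  N^(1/p) or N^(1/\<theta>), with exponents below 1.\<close>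

lemma first_exponent: "\<alpha> < n * (1 - 1 / p)" and second_exponent: "s < n * (1 - inv_exp \<theta>)"
proof -
  obtain e :: 'a where e: "norm e = 1" using norm_Basis SOME_Basis by blast
  \<comment> \<open>Distance 4 is twice the radius 2, as the norm estimate for indicators of balls
    requires.\<close>
  define a where "a = 4 *\<^sub>R e"
  have a: "norm a = 4" using e by (simp add: a_def)
  have near: "x - y \<in> cball a 2" if "x \<in> cball a 1" "norm y \<le> 1" for x y
  proof -
    have "a - (x - y) = (a - x) + y" by simp
    then have "norm (a - (x - y)) \<le> norm (a - x) + norm y" by (metis norm_triangle_ineq)
    then show ?thesis using that by (simp add: dist_norm)
  qed
  define g where "g N = (\<lambda>x::'a. norm x powr (- n) * indicator (dyadic_shell N) x)" for N
  have [measurable]: "g N \<in> borel_measurable borel" for N unfolding g_def by measurable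
  have supp: "norm y \<le> 1" if "g N y \<noteq> 0" for N y
    using that by (auto simp: g_def dyadic_shell_def indicator_def split: if_splits)
  define J where "J N = (\<integral> x. g N x \<partial>lborel)" for N
  have J: "\<omega> / 2 * real N \<le> J N" for N using integral_shell_ge by (simp add: J_def g_def)
  have J0: "0 \<le> J N" for N using J[of N] by (smt (verit) mult_nonneg_nonneg of_nat_0_le_iff ball_vol_nonneg(1) divide_nonneg_pos)
  have w: "0 < \<omega>" by simp
  define u where "u = 4 powr (- \<beta>) * \<omega> powr (1 / q)"
  have u: "0 < u" using w by (simp add: u_def)
  have growth: False
    if k: "k < 1" and est: "\<And>N. 1 \<le> N \<Longrightarrow> J N * u \<le> c * (2 powr n * \<omega> * real N) powr k" for k c
  proof -
    have "1 \<le> k"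
    proof (rule powr_growth)
      fix N :: nat assume N: "6 \<le> N"
      have "\<omega> / 2 * real N * u \<le> J N * u" using J[of N] u by (intro mult_right_mono) auto
      also have "\<dots> \<le> c * (2 powr n * \<omega> * real N) powr k" using est N by simp
      also have "\<dots> = c * (2 powr n * \<omega>) powr k * real N powr k" using w by (simp add: powr_mult)
      finally have "real N \<le> c * (2 powr n * \<omega>) powr k * real N powr k / (\<omega> / 2 * u)"
        using w u by (simp add: pos_le_divide_eq ac_simps)
      then show "real N powr 1 \<le> (c * (2 powr n * \<omega>) powr k / (\<omega> / 2 * u)) * real N powr k" by (simp add: ac_simps)
    qed
    then show False using k by simp
  qed
  show "\<alpha> < n * (1 - 1 / p)"
  proof (rule ccontr)
    assume "\<not> ?thesis"
    then have \<alpha>: "n * (1 - inv_exp (ereal p)) \<le> \<alpha>" by (simp add: inv_exp_p)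
    define M where "M = 2 powr \<bar>s\<bar> * norm a powr s * (\<omega> * 2 powr n) powr inv_exp \<theta>"
    have K: "wnorm \<theta> s (indicator (cball a 2)) \<le> ennreal M"
      unfolding M_def using a by (intro dim_folded(2) th) auto
    have "J N * norm a powr (- \<beta>) * (\<omega> * 1 powr n) powr (1 / q) \<le> 2 powr \<bar>\<beta>\<bar> * C * (2 powr n * \<omega> * real N) powr (1 / p) * M"
      if N: "1 \<le> N" for N
    proof (rule conv_test[OF _ _ _ _ _ K])
      show "wnorm (ereal p) \<alpha> (g N) \<le> ennreal ((2 powr n * \<omega> * real N) powr (1 / p))"
        using wnorm_shell_le[OF p' \<alpha> N] by (simp add: g_def inv_exp_p)
      fix x assume "x \<in> cball a 1"
      then show "conv (g N) (indicator (cball a 2)) x = J N"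
        unfolding J_def using near supp by (intro conv_eq_integral_left) (auto simp: indicator_def)
    qed (use J0 a in \<open>auto simp: M_def\<close>)
    then have "J N * u \<le> (2 powr \<bar>\<beta>\<bar> * C * M) * (2 powr n * \<omega> * real N) powr (1 / p)" if "1 \<le> N" for N
      using that a by (simp add: u_def ac_simps)
    then show False using p by (intro growth[of "1 / p"]) auto
  qed
  show "s < n * (1 - inv_exp \<theta>)"
  proof (rule ccontr)
    assume "\<not> ?thesis"
    then have s: "n * (1 - inv_exp \<theta>) \<le> s" by simp
    define M where "M = 2 powr \<bar>\<alpha>\<bar> * norm a powr \<alpha> * (\<omega> * 2 powr n) powr (1 / p)"
    have f: "wnorm (ereal p) \<alpha> (indicator (cball a 2)) \<le> ennreal M"
      unfolding M_def inv_exp_p[symmetric] using a by (intro dim_folded(2) p') auto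
    have "J N * norm a powr (- \<beta>) * (\<omega> * 1 powr n) powr (1 / q) \<le> 2 powr \<bar>\<beta>\<bar> * C * M * (2 powr n * \<omega> * real N) powr inv_exp \<theta>"
      if N: "1 \<le> N" for N
    proof (rule conv_test[OF _ _ _ _ f])
      show "wnorm \<theta> s (g N) \<le> ennreal ((2 powr n * \<omega> * real N) powr inv_exp \<theta>)"
        using wnorm_shell_le[OF th s N] by (simp add: g_def)
      fix x assume "x \<in> cball a 1"
      then show "conv (indicator (cball a 2)) (g N) x = J N"
        unfolding J_def using near supp by (intro conv_eq_integral_right) (auto simp: indicator_def)
    qed (use J0 a in \<open>auto simp: M_def\<close>)
    then have "J N * u \<le> (2 powr \<bar>\<beta>\<bar> * C * M) * (2 powr n * \<omega> * real N) powr inv_exp \<theta>" if "1 \<le> N" for N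
      using that a by (simp add: u_def ac_simps)
    then show False using inv_exp_bounds by (intro growth[of "inv_exp \<theta>"]) auto
  qed
qed

text \<open>Balls centred at a and -a make the convolution equal to \<omega> on the whole unit ball.
  If \<beta> q >= n, its weighted q-th power there is at least \<omega>^q |x|^(-n), whose integral
  over the shells is unbounded in N. The divergence is at the origin, a region outside the reach of
  \<open>conv_test\<close>.\<close>

lemma output_exponent: "\<beta> < n / q"
proof (rule ccontr)
  assume "\<not> ?thesis"
  then have \<beta>: "n \<le> \<beta> * q" using q by (simp add: field_simps)
  obtain e :: 'a where e: "norm e = 1" using norm_Basis SOME_Basis by blast
  define a where "a = 4 *\<^sub>R e"
  have a: "norm a = 4" using e by (simp add: a_def)
  have w: "0 < \<omega>" by simp
  define M where "M = C * (2 powr \<bar>\<alpha>\<bar> * norm a powr \<alpha> * (\<omega> * 1 powr n) powr (1 / p)) *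
    (2 powr \<bar>s\<bar> * norm (- a) powr s * (\<omega> * 2 powr n) powr inv_exp \<theta>)"
  have M: "0 \<le> M" using C by (simp add: M_def)
  define F where "F = conv (indicator (cball a 1)) (indicator (cball (- a) 2))"
  have "wnorm (ereal q) (- \<beta>) F \<le> ennreal M"
    unfolding M_def F_def inv_exp_p[symmetric]
    using a by (intro wnorm_conv_le dim_folded(2) p' th) auto
  then have le: "(\<integral>\<^sup>+ x. ennreal ((\<bar>F x\<bar> * norm x powr (- \<beta>)) powr q) \<partial>lborel) \<le> ennreal (M powr q)"
    using q M by (subst (asm) wnorm_le_iff) auto
  have F: "F x = \<omega>" if x: "norm x \<le> 1" for x
  proof -
    have "x - y \<in> cball (- a) 2" if "y \<in> cball a 1" for y
    proof -
      have "- a - (x - y) = - (a - y) - x" by simp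
      then have "norm (- a - (x - y)) \<le> norm (a - y) + norm x" by (metis norm_minus_cancel norm_triangle_ineq4)
      then show ?thesis using x that by (simp add: dist_norm)
    qed
    then have "F x = (\<integral> y. indicator (cball a 1) y \<partial>lborel)"
      unfolding F_def by (intro conv_eq_integral_left) (auto simp: indicator_def)
    then show ?thesis using dim_folded(3)[of 1 a] by simp
  qed
  have "\<omega> powr q * (\<omega> / 2) * real N \<le> M powr q" for N :: nat
  proof -
    have "ennreal (\<omega> powr q * (\<omega> / 2) * real N) = ennreal (\<omega> powr q) * ennreal (\<omega> / 2 * real N)"
      using w by (simp add: ennreal_mult[symmetric] mult.assoc)
    also have "\<dots> \<le> ennreal (\<omega> powr q) * (\<integral>\<^sup>+ x. ennreal (norm x powr (- n)) * indicator (dyadic_shell N) (x::'a) \<partial>lborel)"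
      by (intro mult_left_mono dim_folded(4,5)) simp
    also have "\<dots> = (\<integral>\<^sup>+ x. ennreal (\<omega> powr q) * (ennreal (norm x powr (- n)) * indicator (dyadic_shell N) (x::'a)) \<partial>lborel)"
      by (rule nn_integral_cmult[symmetric]) measurable
    also have "\<dots> \<le> (\<integral>\<^sup>+ x. ennreal ((\<bar>F x\<bar> * norm x powr (- \<beta>)) powr q) \<partial>lborel)"
    proof (rule nn_integral_mono)
      fix x :: 'a
      show "ennreal (\<omega> powr q) * (ennreal (norm x powr (- n)) * indicator (dyadic_shell N) x) \<le> ennreal ((\<bar>F x\<bar> * norm x powr (- \<beta>)) powr q)"
      proof (cases "x \<in> dyadic_shell N")
        case True
        then have x: "0 < norm x" "norm x \<le> 1" by (auto simp: dyadic_shell_def intro: less_trans[rotated])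
        have "norm x powr (- n) \<le> norm x powr (- \<beta> * q)" using x \<beta> by (intro powr_mono') auto
        then have "\<omega> powr q * norm x powr (- n) \<le> \<omega> powr q * norm x powr (- \<beta> * q)" by (intro mult_left_mono) auto
        also have "\<dots> = (\<bar>F x\<bar> * norm x powr (- \<beta>)) powr q"
          using F[OF x(2)] w by (simp add: powr_mult powr_powr)
        finally show ?thesis using True by (simp add: ennreal_mult[symmetric] ennreal_leI)
      qed simp
    qed
    also have "\<dots> \<le> ennreal (M powr q)" by (rule le)
    finally show ?thesis by simp
  qed
  moreover have pos: "0 < \<omega> powr q * (\<omega> / 2)" using w by simp
  obtain N :: nat where "M powr q < real N * (\<omega> powr q * (\<omega> / 2))" using reals_Archimedean3[OF pos] by blast
  ultimately show False by (metis mult.commute not_le)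
qed

text \<open>For \<theta> = \<infinity> the scaling identity reads \<alpha> + \<beta> + s = n (1 -
  1/p) + n/q, and \<alpha> and \<beta> are strictly below the two terms on the right.\<close>

lemma kernel_exponent_pos:
  assumes "\<theta> = \<infinity>"
  shows "0 < s"
proof -
  have n: "0 < n" by simp
  have "1 / q = 1 / p + (\<alpha> + \<beta> + s) / n - 1" using scaling assms by (simp add: inv_exp_def)
  then have "\<alpha> + \<beta> + s = n * (1 - 1 / p) + n / q" using n by (simp add: field_simps)
  then show ?thesis using first_exponent output_exponent by linarith
qed

end

text \<open>Integrability almost everywhere belongs to the inclusion because \<open>conv\<close> is
  a Bochner integral, which is 0 where the integrand is not integrable; the norm bound by itself
  would not express that the convolution exists.\<close>

theorem theoremA:
  fixes p q \<alpha> \<beta> s :: real and \<theta> :: ereal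
  defines "n \<equiv> real DIM('a::euclidean_space)"
  assumes "1 < p" and "1 < q" and "1 < \<theta>"
    and "1 / q \<le> 1 / p + inv_exp \<theta>"
  shows "(\<exists>C>0. \<forall>(f::'a \<Rightarrow> real) (K::'a \<Rightarrow> real).
            in_wL (ereal p) \<alpha> f \<and> in_wL \<theta> s K \<longrightarrow>
              (AE x in lborel. integrable lborel (\<lambda>y. K (x - y) * f y)) \<and>
              wnorm (ereal q) (- \<beta>) (conv f K) \<le> ennreal C * wnorm (ereal p) \<alpha> f * wnorm \<theta> s K)
      \<longleftrightarrow>
         (1 / q = 1 / p + inv_exp \<theta> + (\<alpha> + \<beta> + s) / n - 1 \<and>
          \<alpha> < n * (1 - 1 / p) \<and> \<beta> < n / q \<and>
          (if \<theta> = \<infinity> then 0 < s \<and> s < n else s < n * (1 - inv_exp \<theta>)) \<and>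
          0 \<le> \<alpha> + \<beta> \<and> 0 \<le> \<alpha> + s \<and> 0 \<le> \<beta> + s)"
proof
  assume "\<exists>C>0. \<forall>(f::'a \<Rightarrow> real) (K::'a \<Rightarrow> real).
            in_wL (ereal p) \<alpha> f \<and> in_wL \<theta> s K \<longrightarrow>
              (AE x in lborel. integrable lborel (\<lambda>y. K (x - y) * f y)) \<and>
              wnorm (ereal q) (- \<beta>) (conv f K) \<le> ennreal C * wnorm (ereal p) \<alpha> f * wnorm \<theta> s K"
  then obtain C where "0 < C" and "\<And>f K :: 'a \<Rightarrow> real. in_wL (ereal p) \<alpha> f \<Longrightarrow> in_wL \<theta> s K \<Longrightarrow>
      wnorm (ereal q) (- \<beta>) (conv f K) \<le> ennreal C * wnorm (ereal p) \<alpha> f * wnorm \<theta> s K"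
    by blast
  with assms interpret weighted_conv_bound p q \<alpha> \<beta> s C n "unit_ball_vol n" \<theta> "TYPE('a)"
  proof unfold_locales
    show "n \<equiv> real DIM('a)" by (rule n_def)
  qed auto
  show "1 / q = 1 / p + inv_exp \<theta> + (\<alpha> + \<beta> + s) / n - 1 \<and>
          \<alpha> < n * (1 - 1 / p) \<and> \<beta> < n / q \<and>
          (if \<theta> = \<infinity> then 0 < s \<and> s < n else s < n * (1 - inv_exp \<theta>)) \<and>
          0 \<le> \<alpha> + \<beta> \<and> 0 \<le> \<alpha> + s \<and> 0 \<le> \<beta> + s"
    using scaling first_exponent output_exponent second_exponent kernel_exponent_pos pair_sums
    by (cases "\<theta> = \<infinity>") (auto simp: inv_exp_def)
next
  assume R: "1 / q = 1 / p + inv_exp \<theta> + (\<alpha> + \<beta> + s) / n - 1 \<and>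
          \<alpha> < n * (1 - 1 / p) \<and> \<beta> < n / q \<and>
          (if \<theta> = \<infinity> then 0 < s \<and> s < n else s < n * (1 - inv_exp \<theta>)) \<and>
          0 \<le> \<alpha> + \<beta> \<and> 0 \<le> \<alpha> + s \<and> 0 \<le> \<beta> + s"
  \<comment> \<open>For \<theta> = \<infinity> the value of \<open>inv_exp\<close> is 0, so both
    forms of the condition on s give this bound.\<close>
  then have "s < n * (1 - inv_exp \<theta>)"
    by (cases "\<theta> = \<infinity>") (auto simp: inv_exp_def)
  with R assms show "\<exists>C>0. \<forall>(f::'a \<Rightarrow> real) (K::'a \<Rightarrow> real).
            in_wL (ereal p) \<alpha> f \<and> in_wL \<theta> s K \<longrightarrow>
              (AE x in lborel. integrable lborel (\<lambda>y. K (x - y) * f y)) \<and>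
              wnorm (ereal q) (- \<beta>) (conv f K) \<le> ennreal C * wnorm (ereal p) \<alpha> f * wnorm \<theta> s K"
    unfolding n_def by (intro conv_bound_sufficient) auto
qed

end
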